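(* Let $\rho=(r_n)_n$ be an increasing sequence in $[0,1)$ with $r_n\to1$ as $n\to\infty$. The class $\mathcal{U}_A(\mathbb{D},\rho)$ is strongly-algebrable (as a subset of $H(\mathbb{D})$).
   Context: $\mathbb{D}$ is the open unit disc, $\mathbb{T}=\partial\mathbb{D}$ the unit circle, and $H(\mathbb{D})$ the algebra of holomorphic functions on $\mathbb{D}$ (with pointwise operations), endowed with the topology of local uniform convergence. For an increasing sequence $\rho=(r_n)_n$ in $[0,1)$ with $r_n\to1$, $\mathcal{U}_A(\mathbb{D},\rho)$ denotes the set of all $f\in H(\mathbb{D})$ such that: for any compact subset $K\subset\mathbb{T}$, $K\neq\mathbb{T}$, and any continuous function $\varphi:K\to\mathbb{C}$, there exists an increasing sequence $(n_k)_k$ in $\mathbb{N}$ such that $\sup_{\zeta\in K}|f(r_{n_k}\zeta)-\varphi(\zeta)|\to0$ as $k\to\infty$. For a unital commutative algebra $X$ over $\mathbb{C}$ with unit $\mathbf{1}$ and $B\subset X$, the subalgebra generated by $B$ is $\mathcal{A}(B)=\{P(b_1,\dots,b_n): b_1,\dots,b_n\in B,\ P\in\mathbb{C}[t_1,\dots,t_n],\ n\in\mathbb{N}\}$; if $B$ is algebraically independent, $B$ is said to freely generate $\mathcal{A}(B)$. For $X$ also a topological space, a subset $A\subset X$ is strongly-algebrable if $A\cup\{c\cdot\mathbf{1}:c\in\mathbb{C}\}$ contains a subalgebra that is freely generated by an infinite set. *)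

theory Defs
  imports "HOL-Complex_Analysis.Complex_Analysis" "HOL-Library.Poly_Mapping"
begin

section \<open>Unital commutative algebras over the complex numbers\<close>

class comm_complex_algebra_1 = comm_ring_1 +
  fixes scaleC :: "complex \<Rightarrow> 'a \<Rightarrow> 'a"  (infixr \<open>*\<^sub>C\<close> 75)
  assumes scaleC_add_right: "c *\<^sub>C (x + y) = c *\<^sub>C x + c *\<^sub>C y"
    and scaleC_add_left: "(c + d) *\<^sub>C x = c *\<^sub>C x + d *\<^sub>C x"
    and scaleC_scaleC: "c *\<^sub>C d *\<^sub>C x = (c * d) *\<^sub>C x"
    and scaleC_one: "1 *\<^sub>C x = x"
    and mult_scaleC_left: "(c *\<^sub>C x) * y = c *\<^sub>C (x * y)"

text \<open>A polynomial in the variables \<open>t 0, t 1, \<dots>\<close> is a finitely supported map from monomials to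
  coefficients, and a monomial is a finitely supported map from variables to exponents.  The
  polynomials over the first \<open>n\<close> variables form the ring \<open>\<complex>[t\<^sub>1, \<dots>, t\<^sub>n]\<close>.\<close>

type_synonym cpoly = "(nat \<Rightarrow>\<^sub>0 nat) \<Rightarrow>\<^sub>0 complex"

definition cpolys :: "nat \<Rightarrow> cpoly set" where
  "cpolys n = {P. \<forall>m \<in> Poly_Mapping.keys P. Poly_Mapping.keys m \<subseteq> {..<n}}"

definition eval_cpoly :: "cpoly \<Rightarrow> (nat \<Rightarrow> 'a) \<Rightarrow> 'a::comm_complex_algebra_1" where
  "eval_cpoly P b = (\<Sum>m \<in> Poly_Mapping.keys P.
     Poly_Mapping.lookup P m *\<^sub>C (\<Prod>i \<in> Poly_Mapping.keys m. b i ^ Poly_Mapping.lookup m i))"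

definition generated_subalgebra :: "'a::comm_complex_algebra_1 set \<Rightarrow> 'a set" where
  "generated_subalgebra B = {eval_cpoly P b | P b n. P \<in> cpolys n \<and> (\<forall>i<n. b i \<in> B)}"

definition algebraically_independent :: "'a::comm_complex_algebra_1 set \<Rightarrow> bool" where
  "algebraically_independent B \<longleftrightarrow>
     (\<forall>n b P. inj_on b {..<n} \<and> (\<forall>i<n. b i \<in> B) \<and> P \<in> cpolys n \<and> P \<noteq> 0
        \<longrightarrow> eval_cpoly P b \<noteq> 0)"

text \<open>The notion is purely algebraic: no topology on the ambient algebra enters (in contrast to
  its dense variants).\<close>

definition strongly_algebrable :: "'a::comm_complex_algebra_1 set \<Rightarrow> bool" where
  "strongly_algebrable A \<longleftrightarrow>
     (\<exists>B. infinite B \<and> algebraically_independent B \<and>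
          generated_subalgebra B \<subseteq> A \<union> {c *\<^sub>C 1 | c. True})"


section \<open>The algebra of holomorphic functions on the unit disc\<close>

text \<open>A holomorphic function on the disc is represented by its extension by \<open>0\<close> to the whole
  plane, so that equality in the type is equality on the disc.\<close>

typedef disc_hol =
  "{f :: complex \<Rightarrow> complex. f holomorphic_on ball 0 1 \<and> (\<forall>z. z \<notin> ball 0 1 \<longrightarrow> f z = 0)}"
  morphisms hol_fun Abs_disc_hol
  by (rule exI[of _ "\<lambda>_. 0"]) auto

definition to_disc_hol :: "(complex \<Rightarrow> complex) \<Rightarrow> disc_hol" where
  "to_disc_hol f = Abs_disc_hol (\<lambda>z. if z \<in> ball 0 1 then f z else 0)"

lemma holomorphic_hol_fun: "hol_fun f holomorphic_on ball 0 1"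
  using hol_fun[of f] by simp

lemma hol_fun_outside: "z \<notin> ball 0 1 \<Longrightarrow> hol_fun f z = 0"
  using hol_fun[of f] by simp

lemma hol_fun_to_disc_hol:
  assumes "f holomorphic_on ball 0 1"
  shows "hol_fun (to_disc_hol f) = (\<lambda>z. if z \<in> ball 0 1 then f z else 0)"
proof -
  have "(\<lambda>z. if z \<in> ball 0 1 then f z else 0) holomorphic_on ball 0 1"
    using assms by (rule holomorphic_transform) simp
  then show ?thesis
    unfolding to_disc_hol_def by (intro Abs_disc_hol_inverse) auto
qed

lemma disc_hol_eqI:
  assumes "\<And>z. z \<in> ball 0 1 \<Longrightarrow> hol_fun f z = hol_fun g z"
  shows "f = g"
proof -
  have "hol_fun f z = hol_fun g z" for z
    using assms hol_fun_outside by (cases "z \<in> ball 0 1") auto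
  then show ?thesis
    by (auto simp: hol_fun_inject[symmetric])
qed

instantiation disc_hol :: comm_complex_algebra_1
begin

definition "0 = to_disc_hol (\<lambda>z. 0)"
definition "1 = to_disc_hol (\<lambda>z. 1)"
definition "f + g = to_disc_hol (\<lambda>z. hol_fun f z + hol_fun g z)"
definition "f - g = to_disc_hol (\<lambda>z. hol_fun f z - hol_fun g z)"
definition "- f = to_disc_hol (\<lambda>z. - hol_fun f z)"
definition "f * g = to_disc_hol (\<lambda>z. hol_fun f z * hol_fun g z)"
definition "c *\<^sub>C f = to_disc_hol (\<lambda>z. c * hol_fun f z)"

lemma hol_fun_ops:
  assumes "z \<in> ball 0 1"
  shows "hol_fun 0 z = 0" "hol_fun 1 z = 1"
    "hol_fun (f + g) z = hol_fun f z + hol_fun g z"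
    "hol_fun (f - g) z = hol_fun f z - hol_fun g z"
    "hol_fun (- f) z = - hol_fun f z"
    "hol_fun (f * g) z = hol_fun f z * hol_fun g z"
    "hol_fun (c *\<^sub>C f) z = c * hol_fun f z"
  using assms
  unfolding zero_disc_hol_def one_disc_hol_def plus_disc_hol_def minus_disc_hol_def
    uminus_disc_hol_def times_disc_hol_def scaleC_disc_hol_def
  by (simp_all add: hol_fun_to_disc_hol holomorphic_hol_fun holomorphic_intros)

instance
proof
  show "(0::disc_hol) \<noteq> 1"
  proof
    assume "(0::disc_hol) = 1"
    then have "hol_fun 0 0 = hol_fun 1 0" by simp
    then show False by (simp add: hol_fun_ops)
  qed
qed (auto intro!: disc_hol_eqI simp: hol_fun_ops algebra_simps)

end


section \<open>Holomorphic functions universal along a sequence of radii\<close>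

text \<open>The supremum is taken in \<open>[0, \<infinity>]\<close>, so that it is \<open>0\<close> for the admissible set \<open>K = {}\<close>.\<close>

definition U_A :: "(nat \<Rightarrow> real) \<Rightarrow> disc_hol set" where
  "U_A r = {f. \<forall>K \<phi>. compact K \<and> K \<subseteq> sphere 0 1 \<and> K \<noteq> sphere 0 1 \<and> continuous_on K \<phi> \<longrightarrow>
     (\<exists>n :: nat \<Rightarrow> nat. strict_mono n \<and>
        (\<lambda>k. SUP \<zeta>\<in>K. ennreal (norm (hol_fun f (of_real (r (n k)) * \<zeta>) - \<phi> \<zeta>)))
          \<longlonglongrightarrow> 0)}"

lemma SUP_ennreal_norm_tendsto_0_iff:
  fixes g :: "nat \<Rightarrow> 'a \<Rightarrow> 'b::real_normed_vector"
  shows "((\<lambda>k. SUP x\<in>K. ennreal (norm (g k x - h x))) \<longlonglongrightarrow> 0) \<longleftrightarrow>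
         uniform_limit K g h sequentially"
proof
  assume lim: "(\<lambda>k. SUP x\<in>K. ennreal (norm (g k x - h x))) \<longlonglongrightarrow> 0"
  show "uniform_limit K g h sequentially"
  proof (rule uniform_limitI)
    fix e :: real assume "e > 0"
    then have "eventually (\<lambda>k. (SUP x\<in>K. ennreal (norm (g k x - h x))) < ennreal e) sequentially"
      using lim by (intro order_tendstoD(2)) auto
    then show "eventually (\<lambda>k. \<forall>x\<in>K. dist (g k x) (h x) < e) sequentially"
    proof eventually_elim
      case (elim k)
      show ?case
      proof
        fix x assume "x \<in> K"
        then have "ennreal (norm (g k x - h x)) < ennreal e"
          using elim by (meson SUP_upper le_less_trans)
        then show "dist (g k x) (h x) < e"
          by (simp add: dist_norm ennreal_less_iff)
      qed
    qed
  qed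
next
  assume lim: "uniform_limit K g h sequentially"
  show "(\<lambda>k. SUP x\<in>K. ennreal (norm (g k x - h x))) \<longlonglongrightarrow> 0"
  proof (rule order_tendstoI)
    fix a :: ennreal assume "0 < a"
    then obtain b where b: "0 < b" "b < a" using dense by blast
    then obtain e where e: "b = ennreal e" "e > 0"
      by (cases b) (auto simp: top_unique)
    have "eventually (\<lambda>k. \<forall>x\<in>K. dist (g k x) (h x) < e) sequentially"
      using lim e(2) by (rule uniform_limitD)
    then show "eventually (\<lambda>k. (SUP x\<in>K. ennreal (norm (g k x - h x))) < a) sequentially"
    proof eventually_elim
      case (elim k)
      then have "(SUP x\<in>K. ennreal (norm (g k x - h x))) \<le> b"
        unfolding e(1) by (intro SUP_least ennreal_leI) (auto simp: dist_norm less_imp_le)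
      then show ?case using b(2) by (rule le_less_trans)
    qed
  qed auto
qed

end

(*
  Choose holomorphic functions f_0, f_1, ... on the disc which are jointly universal along the radii
  in the following sense: for every compact proper subset K of the circle, every polynomial q with
  rational coefficients and every d, along some r_(n_i) with n_i -> oo all f_j(r_(n_i) z) tend to
  q(z)^(d^j) uniformly on K.  They are sums of polynomials, the k-th of which is small on a disc of
  radius r_(n_k) and corrects the boundary values on the next circle; such polynomials exist by
  Runge's theorem, since the union of a disc and a proper part of a larger circle does not separate
  the plane.

  Given a polynomial P in several variables and d large, P(f_0, f_1, ...) then approximates p(q),
  where p(t) = P(t, t^d, t^(d^2), ...).  For distinct f_j, p = 0 only if P = 0.  If p is constant,
  so is P(f_0, f_1, ...).  Otherwise every continuous function on K is approximated by some p(q),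
  because paths lift approximately through a nonconstant polynomial: a component of the preimage of
  a disc D is mapped onto D, so one can move along a chain of small discs.  Hence
  P(f_0, f_1, ...) belongs to U_A.
*)
theory Submission
  imports Defs
begin

section \<open>Approximate path lifting through polynomials\<close>

text \<open>That K is a proper part of the circle matters twice. It makes the complement of a
  smaller disc together with K connected, so poles of rational functions can be pushed to infinity.
  It also puts K inside an open arc, where lifting meets no monodromy: on the whole circle no
  continuous h makes h^2 uniformly close to the identity, since its winding number is even. The
  targets are tied together as powers of one q so that several variables become one and a single
  approximate equation p(q) = \<phi> remains. The base d must exceed the exponents occurring in P,
  so it cannot be fixed when the f_j are built; every d is therefore among the prescribed tasks.
  Rational coefficients and rational arcs keep the tasks countable. For such d, two monomials of P
  that yield the same power of q are the same monomial in the f_j. Hence p records exactly what is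
  left of P after equal arguments are merged, which gives both the constant case and algebraic
  independence.\<close>

lemma complex_poly_surj:
  fixes p :: "complex poly"
  assumes "degree p > 0"
  obtains z where "poly p z = v"
proof -
  define q where "q = p - [:v:]"
  have "coeff q (degree p) \<noteq> 0"
    using assms by (auto simp: q_def coeff_eq_0)
  then obtain z where "(\<Sum>i\<le>degree p. coeff q i * z ^ i) = 0"
    using assms fundamental_theorem_of_algebra[of "coeff q" "degree p"] by fastforce
  moreover have "degree q = degree p"
    using le_degree[OF \<open>coeff q (degree p) \<noteq> 0\<close>] degree_diff_le[of p "degree p" "[:v:]"]
    by (simp add: q_def)
  ultimately have "poly q z = 0"
    by (simp add: poly_altdef)
  then show thesis
    using that[of z] by (simp add: q_def)
qed

text \<open>The image of the component is open by the open mapping theorem. It is also closed in the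
  ball because \<open>p\<close> is proper: points of the component whose values converge inside the
  ball stay bounded and accumulate at a point of the same component. Connectedness of the ball does
  the rest. No local inverse is used, so critical points of \<open>p\<close> do no harm.\<close>

lemma poly_component_image_ball:
  fixes p :: "complex poly"
  assumes deg: "degree p > 0" and w: "poly p w \<in> ball v e"
  shows "poly p ` connected_component_set (poly p -` ball v e) w = ball v e"
proof -
  define U C where "U = poly p -` ball v e" and "C = connected_component_set U w"
  have open_U: "open U"
    unfolding U_def by (intro open_vimage open_ball continuous_intros)
  have C_sub: "C \<subseteq> U" and wC: "w \<in> C" and conn_C: "connected C"
    using w by (auto simp: C_def U_def connected_component_subset)
  have "open C"
    unfolding C_def by (rule open_connected_component[OF open_U])
  have "\<not> poly p constant_on UNIV"
  proof
    assume "poly p constant_on UNIV"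
    then obtain c where "\<And>z. poly p z = poly [:c:] z"
      by (auto simp: constant_on_def)
    then have "p = [:c:]"
      by (simp flip: poly_eq_poly_eq_iff add: fun_eq_iff)
    with deg show False by simp
  qed
  then have open_img: "open (poly p ` C)"
    using \<open>open C\<close> by (intro open_mapping_thm[of _ UNIV]) (auto intro!: holomorphic_intros)
  have closed_img: "y \<in> poly p ` C" if y: "y \<in> ball v e" "y \<in> closure (poly p ` C)" for y
  proof -
    obtain s where "\<And>n. s n \<in> poly p ` C" and s: "s \<longlonglongrightarrow> y"
      using y(2) by (auto simp: closure_sequential)
    then have "\<forall>n. \<exists>x. x \<in> C \<and> s n = poly p x"
      by blast
    then obtain x where x: "\<And>n. x n \<in> C" and sx: "\<And>n. s n = poly p (x n)"
      by metis
    have "eventually (\<lambda>z. norm (v) + e + 1 \<le> norm (poly p z)) at_infinity"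
      using filterlim_at_infinity_imp_norm_at_top[OF filterlim_poly_at_infinity[OF deg]]
      by (simp add: filterlim_at_top)
    then obtain B where B: "\<And>z. B \<le> norm z \<Longrightarrow> norm v + e + 1 \<le> norm (poly p z)"
      by (auto simp: eventually_at_infinity)
    have "norm (x n) \<le> B" for n
    proof (rule ccontr)
      assume "\<not> norm (x n) \<le> B"
      then have "norm v + e + 1 \<le> norm (poly p (x n))"
        using B by simp
      moreover have "dist v (poly p (x n)) < e"
        using x[of n] C_sub by (auto simp: U_def)
      ultimately show False
        using norm_triangle_ineq2[of "poly p (x n)" v] by (simp add: dist_norm norm_minus_commute)
    qed
    then have "range x \<subseteq> cball 0 B"
      by auto
    then obtain l r where r: "strict_mono (r :: nat \<Rightarrow> nat)" "(x \<circ> r) \<longlonglongrightarrow> l"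
      using compact_cball[of "0::complex" B] unfolding compact_def by blast
    have "(\<lambda>n. poly p ((x \<circ> r) n)) \<longlonglongrightarrow> poly p l"
      by (intro tendsto_intros r)
    moreover have "(\<lambda>n. poly p ((x \<circ> r) n)) \<longlonglongrightarrow> y"
      using LIMSEQ_subseq_LIMSEQ[OF s r(1)] by (simp add: o_def sx)
    ultimately have pl: "poly p l = y"
      by (rule LIMSEQ_unique)
    have "l \<in> closure C"
      unfolding closure_sequential using x r(2) by (intro exI[of _ "x \<circ> r"]) auto
    \<comment> \<open>Adjoining the limit point keeps the component connected and inside the
      preimage, so maximality shows that \<open>l\<close> was in \<open>C\<close> already.\<close>
    then have "connected (insert l C)"
      using closure_subset[of C]
      by (intro connected_intermediate_closure[OF conn_C]) auto
    moreover have "insert l C \<subseteq> U"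
      using C_sub pl y(1) by (auto simp: U_def)
    ultimately have "insert l C \<subseteq> C"
      unfolding C_def using wC by (intro connected_component_maximal) (auto simp: C_def)
    then show ?thesis
      using pl by auto
  qed
  have sub: "poly p ` C \<subseteq> ball v e"
    using C_sub by (auto simp: U_def)
  have "connected (ball v e)" by simp
  moreover have "poly p ` C \<inter> (- closure (poly p ` C)) \<inter> ball v e = {}"
    using closure_subset[of "poly p ` C"] by auto
  moreover have "ball v e \<subseteq> poly p ` C \<union> - closure (poly p ` C)"
    using closed_img by auto
  moreover have "poly p ` C \<inter> ball v e \<noteq> {}"
    using w wC by auto
  ultimately have "- closure (poly p ` C) \<inter> ball v e = {}"
    using connectedD[OF _ open_img, of "ball v e" "- closure (poly p ` C)"] by auto
  then have "ball v e \<subseteq> closure (poly p ` C)"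
    by blast
  then have "ball v e \<subseteq> poly p ` C"
    using closed_img by blast
  with sub show ?thesis
    by (simp add: C_def U_def)
qed

text \<open>The interval is cut into steps on which \<open>g\<close> moves by less than
  \<open>e / 2\<close>. During a step from \<open>a\<close> to \<open>b\<close> the lift stays in
  one component over the ball of radius \<open>e / 2\<close> about \<open>g a\<close>; this
  component contains a preimage of \<open>g b\<close>, and there both \<open>p\<close> of the lift
  and \<open>g\<close> are within \<open>e / 2\<close> of \<open>g a\<close>.\<close>

lemma poly_path_lift_approx:
  fixes p :: "complex poly" and g :: "real \<Rightarrow> complex"
  assumes deg: "degree p > 0" and g: "continuous_on {0..1} g" and "e > 0"
  obtains h where "continuous_on {0..1} h" "\<And>t. t \<in> {0..1} \<Longrightarrow> dist (poly p (h t)) (g t) < e"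
proof -
  have "uniformly_continuous_on {0..1} g"
    by (intro compact_uniformly_continuous g) auto
  then obtain d where d: "d > 0"
    "\<And>s t. s \<in> {0..1} \<Longrightarrow> t \<in> {0..1} \<Longrightarrow> dist t s < d \<Longrightarrow> dist (g t) (g s) < e / 2"
    using \<open>e > 0\<close> unfolding uniformly_continuous_on_def by (meson half_gt_zero)
  obtain N where N: "N > 0" "1 / real N < d"
    using real_arch_inverse[of d] d(1) by (auto simp: inverse_eq_divide)
  \<comment> \<open>The exact value at the right end lets every step start without error, so errors
    do not accumulate.\<close>
  have "\<exists>h. continuous_on {0..real k / N} h \<and> (\<forall>t\<in>{0..real k / N}. dist (poly p (h t)) (g t) < e)
      \<and> poly p (h (real k / N)) = g (real k / N)" if "k \<le> N" for k
    using that
  proof (induction k)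
    case 0
    obtain z where "poly p z = g 0"
      using complex_poly_surj[OF deg] .
    then show ?case
      using \<open>e > 0\<close> by (intro exI[of _ "\<lambda>_. z"]) auto
  next
    case (Suc k)
    define a b where "a = real k / N" and "b = real (Suc k) / N"
    have ab: "0 \<le> a" "a < b" "b \<le> 1" "b - a = 1 / N"
      using Suc.prems N by (auto simp: a_def b_def field_simps)
    from Suc obtain h where h: "continuous_on {0..a} h"
      "\<And>t. t \<in> {0..a} \<Longrightarrow> dist (poly p (h t)) (g t) < e" "poly p (h a) = g a"
      unfolding a_def by force
    define C where "C = connected_component_set (poly p -` ball (g a) (e / 2)) (h a)"
    have ha: "poly p (h a) \<in> ball (g a) (e / 2)"
      using h(3) \<open>e > 0\<close> by simp
    have C: "poly p ` C = ball (g a) (e / 2)"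
      unfolding C_def by (rule poly_component_image_ball[OF deg ha])
    have "g b \<in> ball (g a) (e / 2)"
      using d(2)[of b a] ab N by (auto simp: dist_norm)
    then obtain z where z: "z \<in> C" "poly p z = g b"
      using C by (metis imageE)
    have "open C"
      unfolding C_def
      by (intro open_connected_component open_vimage open_ball continuous_intros)
    moreover have "connected C"
      by (simp add: C_def)
    moreover have "h a \<in> C"
      using ha by (simp add: C_def)
    ultimately obtain q where q: "path q" "path_image q \<subseteq> C" "pathstart q = h a" "pathfinish q = z"
      using z(1) connected_open_path_connected[of C] unfolding path_connected_def by metis
    define f where "f = (\<lambda>t. if t \<le> a then h t else q ((t - a) / (b - a)))"
    have rescale: "(t - a) / (b - a) \<in> {0..1}" if "t \<in> {a..b}" for t
      using that ab by (auto simp: divide_simps)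
    have "continuous_on {0..b} f"
      unfolding f_def
    proof (rule continuous_on_cases_le)
      show "continuous_on {t \<in> {0..b}. t \<le> a} h"
        by (rule continuous_on_subset[OF h(1)]) auto
      show "continuous_on {t \<in> {0..b}. a \<le> t} (\<lambda>t. q ((t - a) / (b - a)))"
      proof (rule continuous_on_compose2[of "{0..1}" q])
        show "continuous_on {0..1} q"
          using q(1) by (simp add: path_def)
        show "continuous_on {t \<in> {0..b}. a \<le> t} (\<lambda>t. (t - a) / (b - a))"
          using ab(2) by (intro continuous_intros) auto
        show "(\<lambda>t. (t - a) / (b - a)) ` {t \<in> {0..b}. a \<le> t} \<subseteq> {0..1}"
          using rescale by fastforce
      qed
    qed (use q in \<open>auto simp: pathstart_def\<close>)
    moreover have "dist (poly p (f t)) (g t) < e" if t: "t \<in> {0..b}" for t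
    proof (cases "t \<le> a")
      case True
      then show ?thesis using h(2) t by (simp add: f_def)
    next
      case False
      then have "f t \<in> C"
        using q(2) rescale[of t] t by (auto simp: f_def path_image_def)
      then have "poly p (f t) \<in> ball (g a) (e / 2)"
        using C by blast
      moreover have "dist (g t) (g a) < e / 2"
        using d(2)[of a t] ab N t False by (auto simp: dist_norm)
      ultimately show ?thesis
        using dist_triangle_half_l[of "poly p (f t)" "g a" e "g t"]
        by (simp add: dist_commute)
    qed
    moreover have "poly p (f b) = g b"
      using ab(2) q(4) z(2) by (simp add: f_def pathfinish_def)
    ultimately show ?case
      unfolding b_def by blast
  qed
  from this[of N] N obtain h where "continuous_on {0..1} h"
    "\<forall>t\<in>{0..1}. dist (poly p (h t)) (g t) < e"
    by auto
  then show thesis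
    using that by blast
qed

section \<open>Runge approximation on a disc and a part of a circle\<close>

text \<open>For compact \<open>E\<close> these functions form a uniformly closed algebra. The
  instance of Runge's theorem needed here comes from such closure properties and explicit rational
  functions, rather than from Cauchy integrals.\<close>

definition poly_approximable :: "complex set \<Rightarrow> (complex \<Rightarrow> complex) \<Rightarrow> bool" where
  "poly_approximable E f \<longleftrightarrow> (\<forall>e>0. \<exists>p. \<forall>z\<in>E. dist (poly p z) (f z) < e)"

lemma poly_approximableD:
  assumes "poly_approximable E f" "e > 0"
  obtains p where "\<And>z. z \<in> E \<Longrightarrow> dist (poly p z) (f z) < e"
  using assms unfolding poly_approximable_def by blast

lemma poly_approximable_poly: "poly_approximable E (poly p)"
  unfolding poly_approximable_def by (auto intro!: exI[of _ p])

lemma poly_approximable_const: "poly_approximable E (\<lambda>_. c)"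
  using poly_approximable_poly[of E "[:c:]"] by (simp add: poly_approximable_def)

lemma poly_approximable_id: "poly_approximable E (\<lambda>z. z)"
  using poly_approximable_poly[of E "[:0, 1:]"] by (simp add: poly_approximable_def)

lemma poly_approximable_cong:
  "(\<And>z. z \<in> E \<Longrightarrow> f z = g z) \<Longrightarrow> poly_approximable E f \<longleftrightarrow> poly_approximable E g"
  by (simp add: poly_approximable_def)

lemma poly_approximable_limit:
  assumes "\<And>e. e > 0 \<Longrightarrow> \<exists>g. poly_approximable E g \<and> (\<forall>z\<in>E. dist (g z) (f z) < e)"
  shows "poly_approximable E f"
  unfolding poly_approximable_def
proof (intro allI impI)
  fix e :: real assume "e > 0"
  then obtain g where g: "poly_approximable E g" "\<forall>z\<in>E. dist (g z) (f z) < e / 2"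
    using assms[of "e / 2"] by auto
  obtain p where p: "\<And>z. z \<in> E \<Longrightarrow> dist (poly p z) (g z) < e / 2"
    using poly_approximableD[OF g(1)] \<open>e > 0\<close> half_gt_zero by blast
  show "\<exists>p. \<forall>z\<in>E. dist (poly p z) (f z) < e"
    using p g(2) by (intro exI[of _ p]) (metis dist_commute dist_triangle_half_l)
qed

lemma poly_approximable_add:
  assumes "poly_approximable E f" "poly_approximable E g"
  shows "poly_approximable E (\<lambda>z. f z + g z)"
  unfolding poly_approximable_def
proof (intro allI impI)
  fix e :: real assume "e > 0"
  then obtain p q where pq: "\<And>z. z \<in> E \<Longrightarrow> dist (poly p z) (f z) < e / 2"
      "\<And>z. z \<in> E \<Longrightarrow> dist (poly q z) (g z) < e / 2"
    using poly_approximableD[OF assms(1)] poly_approximableD[OF assms(2)] half_gt_zero by metis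
  show "\<exists>p. \<forall>z\<in>E. dist (poly p z) (f z + g z) < e"
  proof (intro exI[of _ "p + q"] ballI)
    fix z assume "z \<in> E"
    then show "dist (poly (p + q) z) (f z + g z) < e"
      using pq[of z] dist_triangle_add[of "poly p z" "poly q z" "f z" "g z"] by simp
  qed
qed

lemma poly_approximable_bounded:
  assumes "poly_approximable E f" "compact E"
  obtains B where "B > 0" "\<And>z. z \<in> E \<Longrightarrow> norm (f z) \<le> B"
proof -
  obtain p where p: "\<And>z. z \<in> E \<Longrightarrow> dist (poly p z) (f z) < 1"
    using poly_approximableD[OF assms(1), of 1] by auto
  have "compact (poly p ` E)"
    by (intro compact_continuous_image assms continuous_intros)
  then obtain B where B: "B > 0" "\<And>z. z \<in> E \<Longrightarrow> norm (poly p z) \<le> B"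
    by (auto dest!: compact_imp_bounded simp: bounded_pos)
  show thesis
  proof (rule that[of "B + 1"])
    fix z assume "z \<in> E"
    then show "norm (f z) \<le> B + 1"
      using p[of z] B(2)[of z] norm_triangle_ineq2[of "f z" "poly p z"]
      by (simp add: dist_norm norm_minus_commute)
  qed (use B in auto)
qed

lemma poly_approximable_mult:
  assumes f: "poly_approximable E f" and g: "poly_approximable E g" and E: "compact E"
  shows "poly_approximable E (\<lambda>z. f z * g z)"
proof (rule poly_approximable_limit)
  fix e :: real assume "e > 0"
  obtain B where B: "B > 0" "\<And>z. z \<in> E \<Longrightarrow> norm (f z) \<le> B"
    using poly_approximable_bounded[OF f E] by blast
  obtain q where q: "\<And>z. z \<in> E \<Longrightarrow> dist (poly q z) (g z) < e / B / 2"
    using poly_approximableD[OF g, of "e / B / 2"] \<open>e > 0\<close> B(1) by auto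
  have "compact (poly q ` E)"
    by (intro compact_continuous_image E continuous_intros)
  then obtain D where D: "D > 0" "\<And>z. z \<in> E \<Longrightarrow> norm (poly q z) \<le> D"
    by (auto dest!: compact_imp_bounded simp: bounded_pos)
  obtain p where p: "\<And>z. z \<in> E \<Longrightarrow> dist (poly p z) (f z) < e / D / 2"
    using poly_approximableD[OF f, of "e / D / 2"] \<open>e > 0\<close> D(1) by auto
  show "\<exists>h. poly_approximable E h \<and> (\<forall>z\<in>E. dist (h z) (f z * g z) < e)"
  proof (intro exI conjI ballI)
    show "poly_approximable E (poly (p * q))"
      by (rule poly_approximable_poly)
    fix z assume z: "z \<in> E"
    have "poly (p * q) z - f z * g z = (poly p z - f z) * poly q z + f z * (poly q z - g z)"
      by (simp add: algebra_simps)
    then have "norm (poly (p * q) z - f z * g z)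
        \<le> norm (poly p z - f z) * norm (poly q z) + norm (f z) * norm (poly q z - g z)"
      by (metis norm_mult norm_triangle_ineq)
    also have "\<dots> \<le> norm (poly p z - f z) * D + B * norm (poly q z - g z)"
      using B D z by (intro add_mono mult_left_mono mult_right_mono) auto
    also have "\<dots> < (e / D / 2) * D + B * (e / B / 2)"
      using p[OF z] q[OF z] B(1) D(1)
      by (intro add_strict_mono mult_strict_left_mono mult_strict_right_mono) (auto simp: dist_norm)
    also have "\<dots> = e"
      using B(1) D(1) by simp
    finally show "dist (poly (p * q) z) (f z * g z) < e"
      by (simp add: dist_norm)
  qed
qed

lemma poly_approximable_power:
  assumes "poly_approximable E f" "compact E"
  shows "poly_approximable E (\<lambda>z. f z ^ n)"
  by (induction n) (auto intro: poly_approximable_const poly_approximable_mult assms)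

lemma poly_approximable_sum:
  assumes "\<And>i. i \<in> I \<Longrightarrow> poly_approximable E (f i)"
  shows "poly_approximable E (\<lambda>z. \<Sum>i\<in>I. f i z)"
  using assms
  by (induction I rule: infinite_finite_induct)
     (auto intro: poly_approximable_const poly_approximable_add)

text \<open>Neumann series: the powers of \<open>1 - g\<close> sum to \<open>1 / g\<close>,
  uniformly because \<open>1 - g\<close> is bounded by \<open>q < 1\<close>. Stopping after
  \<open>N\<close> terms costs at most \<open>q ^ N / (1 - q)\<close>.\<close>

lemma poly_approximable_inverse:
  assumes g: "poly_approximable E g" and E: "compact E"
    and q: "q < 1" "\<And>z. z \<in> E \<Longrightarrow> dist (g z) 1 \<le> q"
  shows "poly_approximable E (\<lambda>z. inverse (g z))"
proof (cases "E = {}")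
  case True
  then show ?thesis by (simp add: poly_approximable_def)
next
  case False
  then have "q \<ge> 0"
    using q(2) zero_le_dist order_trans by blast
  show ?thesis
  proof (rule poly_approximable_limit)
    fix e :: real assume "e > 0"
    then obtain N where N: "q ^ N < e * (1 - q)"
      using real_arch_pow_inv[of "e * (1 - q)" q] q(1) by auto
    show "\<exists>h. poly_approximable E h \<and> (\<forall>z\<in>E. dist (h z) (inverse (g z)) < e)"
    proof (intro exI conjI ballI)
      \<comment> \<open>The difference is spelled as \<open>1 + (- 1) * g z\<close> to fit the
        closure rules for sums and products.\<close>
      show "poly_approximable E (\<lambda>z. \<Sum>n<N. (1 + (- 1) * g z) ^ n)"
        by (intro poly_approximable_sum poly_approximable_power poly_approximable_add
            poly_approximable_mult poly_approximable_const g E)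
      fix z assume z: "z \<in> E"
      have gz: "norm (1 - g z) \<le> q"
        using q(2)[OF z] by (simp add: dist_norm norm_minus_commute)
      then have g_ge: "1 - q \<le> norm (g z)"
        using norm_triangle_ineq2[of 1 "1 - g z"] by simp
      then have nz: "g z \<noteq> 0"
        using q(1) by auto
      have "(\<Sum>n<N. (1 + (- 1) * g z) ^ n) = (1 - (1 - g z) ^ N) / g z"
        using nz sum_gp_strict[of "1 - g z" N] by simp
      then have "(\<Sum>n<N. (1 + (- 1) * g z) ^ n) - inverse (g z) = - ((1 - g z) ^ N / g z)"
        by (simp only: diff_divide_distrib inverse_eq_divide) simp
      then have "dist (\<Sum>n<N. (1 + (- 1) * g z) ^ n) (inverse (g z)) = norm (1 - g z) ^ N / norm (g z)"
        by (simp add: dist_norm norm_divide norm_power)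
      also have "\<dots> \<le> q ^ N / (1 - q)"
        using g_ge gz q(1) \<open>q \<ge> 0\<close> by (intro frac_le power_mono) auto
      also have "\<dots> < e"
        using N q(1) by (simp add: field_simps)
      finally show "dist (\<Sum>n<N. (1 + (- 1) * g z) ^ n) (inverse (g z)) < e" .
    qed
  qed
qed

text \<open>Pushing a pole from \<open>a\<close> to \<open>b\<close>: \<open>z - b\<close> is
  \<open>z - a\<close> times \<open>1 + (a - b) / (z - a)\<close>, and the quotient has modulus at
  most 1/2 on \<open>E\<close>, so the second factor can be inverted by a geometric series.\<close>

lemma poly_approximable_resolvent_shift:
  assumes a: "poly_approximable E (\<lambda>z. inverse (z - a))" and E: "compact E"
    and "a \<notin> E" "\<And>z. z \<in> E \<Longrightarrow> 2 * dist a b \<le> dist z a"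
  shows "poly_approximable E (\<lambda>z. inverse (z - b))"
proof -
  have nz: "z - a \<noteq> 0" if "z \<in> E" for z
    using that assms(3) by auto
  have "poly_approximable E (\<lambda>z. inverse (1 + (a - b) * inverse (z - a)))"
  proof (rule poly_approximable_inverse[where q = "1 / 2"])
    fix z assume z: "z \<in> E"
    have "dist (1 + (a - b) * inverse (z - a)) 1 = dist a b / dist z a"
      by (simp add: dist_norm norm_mult norm_inverse divide_inverse)
    also have "\<dots> \<le> 1 / 2"
      using assms(4)[OF z] nz[OF z] by (simp add: field_simps)
    finally show "dist (1 + (a - b) * inverse (z - a)) 1 \<le> 1 / 2" .
  qed (intro poly_approximable_add poly_approximable_mult poly_approximable_const a E | simp)+
  then have "poly_approximable E (\<lambda>z. inverse (z - a) * inverse (1 + (a - b) * inverse (z - a)))"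
    by (intro poly_approximable_mult a E)
  moreover have "inverse (z - a) * inverse (1 + (a - b) * inverse (z - a)) = inverse (z - b)"
    if "z \<in> E" for z
  proof -
    have "(z - a) * (1 + (a - b) * inverse (z - a)) = z - b"
      using nz[OF that] by (simp add: field_simps)
    then show ?thesis
      by (metis inverse_mult_distrib)
  qed
  ultimately show ?thesis
    by (simp cong: poly_approximable_cong)
qed

text \<open>The admissible poles form a subset of the complement of \<open>E\<close> that is open
  and has open complement there, both by pole pushing. A pole far away is admissible by a geometric
  series, and connectedness carries this to every pole.\<close>

lemma poly_approximable_resolvent:
  assumes E: "compact E" and conn: "connected (- E)" and b: "b \<notin> E"
  shows "poly_approximable E (\<lambda>z. inverse (z - b))"
proof (rule ccontr)
  assume contr: "\<not> poly_approximable E (\<lambda>z. inverse (z - b))"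
  define S where "S = {a. a \<notin> E \<and> poly_approximable E (\<lambda>z. inverse (z - a))}"
  have "open (- E)"
    using E compact_imp_closed by blast
  then have near: "\<exists>d>0. ball a d \<subseteq> - E" if "a \<notin> E" for a
    using that open_contains_ball by auto
  have far: "d \<le> dist z a" if "ball a d \<subseteq> - E" "z \<in> E" for a d z
    using that by (metis ComplD dist_commute linorder_not_less mem_ball subsetD)
  have "open S"
    unfolding open_contains_ball
  proof
    fix a assume a: "a \<in> S"
    then obtain d where d: "d > 0" "ball a d \<subseteq> - E"
      using near by (auto simp: S_def)
    have "ball a (d / 2) \<subseteq> S"
    proof
      fix c assume c: "c \<in> ball a (d / 2)"
      have "poly_approximable E (\<lambda>z. inverse (z - c))"
      proof (rule poly_approximable_resolvent_shift[of E a, OF _ E])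
        fix z assume "z \<in> E"
        then show "2 * dist a c \<le> dist z a"
          using far[OF d(2)] c by force
      qed (use a in \<open>auto simp: S_def\<close>)
      moreover have "c \<in> ball a d"
        using c d(1) by simp
      ultimately show "c \<in> S"
        using d(2) by (auto simp: S_def)
    qed
    then show "\<exists>e>0. ball a e \<subseteq> S"
      using d(1) half_gt_zero by blast
  qed
  moreover have "open (- E - S)"
    unfolding open_contains_ball
  proof
    fix a assume a: "a \<in> - E - S"
    then obtain d where d: "d > 0" "ball a d \<subseteq> - E"
      using near by auto
    \<comment> \<open>Here the pole moves from \<open>c\<close> to the centre \<open>a\<close>, so
      the distance of \<open>E\<close> from \<open>c\<close> counts. It exceeds
      \<open>d - d / 3\<close>, hence twice the distance moved.\<close>
    have "ball a (d / 3) \<subseteq> - E - S"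
    proof
      fix c assume c: "c \<in> ball a (d / 3)"
      have "c \<notin> S"
      proof
        assume "c \<in> S"
        moreover have "2 * dist c a \<le> dist z c" if "z \<in> E" for z
          using far[OF d(2) that] c dist_triangle[of z a c] by (simp add: dist_commute)
        ultimately have "poly_approximable E (\<lambda>z. inverse (z - a))"
          by (intro poly_approximable_resolvent_shift[of E c a, OF _ E]) (auto simp: S_def)
        with a show False
          by (simp add: S_def)
      qed
      moreover have "c \<in> ball a d"
        using c d(1) by simp
      ultimately show "c \<in> - E - S"
        using d(2) by blast
    qed
    then show "\<exists>e>0. ball a e \<subseteq> - E - S"
      using d(1) by (metis zero_less_divide_iff zero_less_numeral)
  qed
  ultimately have "S \<inter> - E = {} \<or> (- E - S) \<inter> - E = {}"
    by (intro connectedD[OF conn]) auto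
  then have "S = {}"
    using b contr by (auto simp: S_def)
  obtain R where R: "R > 0" "\<And>z. z \<in> E \<Longrightarrow> norm z \<le> R"
    using compact_imp_bounded[OF E] by (auto simp: bounded_pos)
  \<comment> \<open>With this modulus \<open>z / a\<close> is at most 1/2 on \<open>E\<close>, so
    the expansion of \<open>1 / (z - a)\<close> in powers of \<open>z\<close> converges
    uniformly.\<close>
  define a where "a = complex_of_real (2 * R)"
  have na: "norm a = 2 * R" "a \<noteq> 0"
    using R(1) by (auto simp: a_def)
  have "poly_approximable E (\<lambda>z. inverse (1 + (- inverse a) * z))"
  proof (rule poly_approximable_inverse[where q = "1 / 2"])
    fix z assume "z \<in> E"
    then show "dist (1 + (- inverse a) * z) 1 \<le> 1 / 2"
      using R(1) R(2)[of z] na by (simp add: dist_norm norm_divide field_simps)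
  qed (intro poly_approximable_add poly_approximable_mult poly_approximable_const
       poly_approximable_id E | simp)+
  then have "poly_approximable E (\<lambda>z. (- inverse a) * inverse (1 + (- inverse a) * z))"
    by (intro poly_approximable_mult poly_approximable_const E)
  moreover have "(- inverse a) * inverse (1 + (- inverse a) * z) = inverse (z - a)" for z
  proof -
    have "(- a) * (1 + (- inverse a) * z) = z - a"
      using na by (simp add: field_simps)
    then show ?thesis
      by (metis inverse_minus_eq inverse_mult_distrib)
  qed
  ultimately have "a \<in> S"
    using R na by (force simp: S_def)
  with \<open>S = {}\<close> show False by simp
qed

text \<open>Split off one linear factor at a time; each zero lies outside \<open>E\<close>, so the
  reciprocal of its factor is an approximable resolvent.\<close>

lemma poly_approximable_inverse_poly:
  assumes E: "compact E" "connected (- E)"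
    and "p \<noteq> 0" "\<And>z. z \<in> E \<Longrightarrow> poly p z \<noteq> 0"
  shows "poly_approximable E (\<lambda>z. inverse (poly p z))"
  using assms(3,4)
proof (induction "degree p" arbitrary: p)
  case 0
  then obtain c where "p = [:c:]"
    by (metis degree_eq_zeroE)
  then show ?case
    by (simp add: poly_approximable_const)
next
  case (Suc n)
  then obtain a where a: "poly p a = 0"
    using complex_poly_surj[of p 0] by auto
  then obtain q where q: "p = [:- a, 1:] * q"
    by (auto simp: poly_eq_0_iff_dvd dvd_def)
  have "q \<noteq> 0"
    using Suc.prems q by auto
  then have "degree p = Suc (degree q)"
    unfolding q by (subst degree_mult_eq) auto
  then have "poly_approximable E (\<lambda>z. inverse (poly q z))"
    using Suc.hyps Suc.prems \<open>q \<noteq> 0\<close> q by auto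
  moreover have "poly_approximable E (\<lambda>z. inverse (z - a))"
    using a Suc.prems by (intro poly_approximable_resolvent E) auto
  ultimately have "poly_approximable E (\<lambda>z. inverse (z - a) * inverse (poly q z))"
    using E by (intro poly_approximable_mult)
  moreover have "inverse (z - a) * inverse (poly q z) = inverse (poly p z)" for z
    by (simp add: q flip: inverse_mult_distrib) (simp add: algebra_simps)
  ultimately show ?case
    by simp
qed

text \<open>The complement is a union of sets \<open>X w\<close>, one for each point
  \<open>w\<close> of the circle outside \<open>K\<close>. Each consists of the open annulus, the
  exterior, and a ray through \<open>w\<close> that starts just outside the inner disc and joins the
  two. All of them share the exterior.\<close>

lemma connected_compl_cball_Un_circle_part:
  fixes K :: "complex set"
  assumes \<rho>: "0 \<le> \<rho>" "\<rho> < r" and K: "K \<subseteq> sphere 0 r" "K \<noteq> sphere 0 r"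
  shows "connected (- (cball 0 \<rho> \<union> K))"
proof -
  define A where "A = {z::complex. \<rho> < norm z \<and> norm z < r}"
  define L where "L w = (\<lambda>t. complex_of_real t * w) ` {\<rho> / r <..}" for w :: complex
  define X where "X w = A \<union> L w \<union> {z. r < norm z}" for w
  have conn_A: "connected A"
    unfolding A_def using connected_annulus(1)[where a = "0::complex" and ?r1.0 = \<rho> and ?r2.0 = r] by simp
  have conn_out: "connected {z::complex. r < norm z}"
    using connected_complement_bounded_convex[of "cball (0::complex) r"]
    by (simp add: Compl_eq not_le)
  have norm_L: "norm (complex_of_real t * w) = t * r" if "norm w = r" "t > \<rho> / r" for t w
    using that \<rho> by (auto simp: norm_mult) (smt (verit) divide_nonneg_nonneg)
  have conn_X: "connected (X w)" if w: "norm w = r" for w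
  proof -
    have "connected (L w)"
      unfolding L_def by (intro connected_continuous_image continuous_intros) auto
    moreover have "complex_of_real ((\<rho> / r + 1) / 2) * w \<in> A \<inter> L w"
    proof -
      have *: "(\<rho> / r + 1) / 2 > \<rho> / r"
        using \<rho> by (simp add: field_simps)
      then have "complex_of_real ((\<rho> / r + 1) / 2) * w \<in> L w"
        unfolding L_def by (intro imageI) simp
      moreover have "(\<rho> / r + 1) / 2 * r = (\<rho> + r) / 2"
        using \<rho> by (simp add: field_simps)
      ultimately show ?thesis
        using norm_L[OF w *] \<rho> by (simp add: A_def)
    qed
    moreover have "complex_of_real 2 * w \<in> L w \<inter> {z. r < norm z}"
    proof -
      have *: "2 > \<rho> / r"
        using \<rho> by (simp add: field_simps)
      then have "complex_of_real 2 * w \<in> L w"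
        unfolding L_def by (intro imageI) simp
      then show ?thesis
        using norm_L[OF w *] \<rho> by simp
    qed
    ultimately have "connected (A \<union> L w)" "(A \<union> L w) \<inter> {z. r < norm z} \<noteq> {}"
      using conn_A by (blast intro: connected_Un)+
    then show ?thesis
      unfolding X_def using conn_out by (intro connected_Un[of "A \<union> L w"])
  qed
  have eq: "- (cball 0 \<rho> \<union> K) = (\<Union>w \<in> sphere 0 r - K. X w)"
  proof (intro equalityI subsetI)
    fix z assume z: "z \<in> - (cball 0 \<rho> \<union> K)"
    obtain w where "w \<in> sphere 0 r - K"
      using K by blast
    moreover have "z \<in> L z"
      unfolding L_def using \<rho> by (intro image_eqI[of _ _ 1]) auto
    ultimately show "z \<in> (\<Union>w \<in> sphere 0 r - K. X w)"
      using z by (cases "norm z = r") (auto simp: X_def A_def)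
  next
    fix z assume "z \<in> (\<Union>w \<in> sphere 0 r - K. X w)"
    then obtain w where w: "norm w = r" "w \<notin> K" "z \<in> X w"
      by auto
    then consider "z \<in> A" | "r < norm z" | t where "t > \<rho> / r" "z = complex_of_real t * w"
      by (auto simp: X_def L_def)
    then show "z \<in> - (cball 0 \<rho> \<union> K)"
    proof cases
      case 3
      then have nz: "norm z = t * r"
        using norm_L w by simp
      have "z \<notin> K"
      proof
        assume "z \<in> K"
        then have "t = 1"
          using K nz \<rho> by auto
        with 3 w \<open>z \<in> K\<close> show False by simp
      qed
      moreover have "\<rho> < t * r"
        using 3 \<rho> by (simp add: field_simps)
      ultimately show ?thesis
        using nz by simp
    qed (use K \<rho> in \<open>auto simp: A_def\<close>)
  qed
  show ?thesis
    unfolding eq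
  proof (rule connected_Union)
    show "connected S" if "S \<in> X ` (sphere 0 r - K)" for S
      using that conn_X by auto
    show "\<Inter> (X ` (sphere 0 r - K)) \<noteq> {}"
    proof -
      have "complex_of_real (2 * r) \<in> X w" for w
        using \<rho> by (simp add: X_def)
      then show ?thesis by blast
    qed
  qed
qed

text \<open>With \<open>s\<close> strictly between the radii, the rational function
  \<open>z ^ M / (z ^ (M + 1) - s ^ (M + 1))\<close> acts as a switch: for large \<open>M\<close> it
  is close to 0 inside the circle of radius \<open>s\<close> and close to \<open>1 / z\<close>
  outside. Its poles have modulus \<open>s\<close> and so avoid the set.\<close>

lemma poly_approximable_zero_inverse:
  fixes K :: "complex set"
  assumes \<rho>: "0 \<le> \<rho>" "\<rho> < r" and K: "compact K" "K \<subseteq> sphere 0 r" "K \<noteq> sphere 0 r"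
  shows "poly_approximable (cball 0 \<rho> \<union> K) (\<lambda>z. if norm z \<le> \<rho> then 0 else inverse z)"
proof (rule poly_approximable_limit)
  fix e :: real assume "e > 0"
  let ?E = "cball 0 \<rho> \<union> K"
  have E: "compact ?E" "connected (- ?E)"
    using K connected_compl_cball_Un_circle_part[OF \<rho> K(2,3)] by (auto intro: compact_Un)
  define s where "s = (\<rho> + r) / 2"
  have s: "s > 0" "\<rho> < s" "s < r"
    using \<rho> by (auto simp: s_def)
  \<comment> \<open>A single ratio below 1 that serves both inside (\<open>\<rho>\<close> against
    \<open>s\<close>) and outside (\<open>s\<close> against \<open>r\<close>).\<close>
  define x where "x = max (\<rho> / s) (s / r)"
  have x: "0 < x" "x < 1" "\<rho> \<le> s * x" "s \<le> r * x"
  proof -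
    show "0 < x" "x < 1"
      using s by (auto simp: x_def less_max_iff_disj)
    have "s * (\<rho> / s) \<le> s * x" "r * (s / r) \<le> r * x"
      using s unfolding x_def by (intro mult_left_mono; simp)+
    then show "\<rho> \<le> s * x" "s \<le> r * x"
      using s by auto
  qed
  \<comment> \<open>The bound 1/2 keeps the denominator of \<open>G\<close> at least half its
    dominant term in both regions; the bound \<open>e * s / 2\<close> makes the resulting error
    \<open>2 * x ^ M / s\<close> smaller than \<open>e\<close>.\<close>
  obtain M where M: "x ^ M < min (1 / 2) (e * s / 2)"
    using real_arch_pow_inv[of "min (1 / 2) (e * s / 2)" x] x s \<open>e > 0\<close> by auto
  have xS: "x ^ Suc M \<le> x ^ M"
    using x by (simp add: mult_left_le_one_le)
  define G where "G z = z ^ M * inverse (z ^ Suc M - of_real (s ^ Suc M))" for z :: complex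
  have near: "s ^ Suc M / 2 \<le> norm (z ^ Suc M - of_real (s ^ Suc M))" if "norm z \<le> \<rho>" for z :: complex
  proof -
    have "norm (z ^ Suc M) \<le> (s * x) ^ Suc M"
      unfolding norm_power using that x by (intro power_mono) auto
    also have "\<dots> \<le> s ^ Suc M * (1 / 2)"
      unfolding power_mult_distrib using M xS s by (intro mult_left_mono) auto
    finally show ?thesis
      using norm_triangle_ineq2[of "of_real (s ^ Suc M)" "z ^ Suc M"] s
      by (simp add: norm_minus_commute norm_mult norm_power)
  qed
  have far: "r ^ Suc M / 2 \<le> norm (z ^ Suc M - of_real (s ^ Suc M))" if "norm z = r" for z :: complex
  proof -
    have "s ^ Suc M \<le> (r * x) ^ Suc M"
      using x s by (intro power_mono) auto
    also have "\<dots> \<le> r ^ Suc M * (1 / 2)"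
      unfolding power_mult_distrib using M xS s by (intro mult_left_mono) auto
    finally show ?thesis
      using norm_triangle_ineq2[of "z ^ Suc M" "of_real (s ^ Suc M)"] s that
      by (simp add: norm_mult norm_power)
  qed
  have nz: "z ^ Suc M - of_real (s ^ Suc M) \<noteq> 0" if "z \<in> ?E" for z :: complex
  proof -
    have "s ^ Suc M / 2 > 0" "r ^ Suc M / 2 > 0"
      using s by auto
    moreover have "norm z \<le> \<rho> \<or> norm z = r"
      using that K by auto
    ultimately show ?thesis
      using near[of z] far[of z] by auto
  qed
  show "\<exists>g. poly_approximable ?E g \<and> (\<forall>z\<in>?E. dist (g z) (if norm z \<le> \<rho> then 0 else inverse z) < e)"
  proof (intro exI conjI ballI)
    have p: "poly (monom 1 (Suc M) - [:of_real (s ^ Suc M):]) z = z ^ Suc M - of_real (s ^ Suc M)" for z :: complex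
      by (simp add: poly_monom)
    have "poly_approximable ?E (\<lambda>z. inverse (poly (monom 1 (Suc M) - [:of_real (s ^ Suc M):]) z))"
    proof (rule poly_approximable_inverse_poly[OF E])
      have "0 \<in> ?E" using \<rho> by simp
      then have "poly (monom 1 (Suc M) - [:of_real (s ^ Suc M):]) (0::complex) \<noteq> 0"
        unfolding p by (rule nz)
      then show "monom 1 (Suc M) - [:of_real (s ^ Suc M):] \<noteq> (0 :: complex poly)"
        by (metis poly_0)
    qed (simp only: p nz not_False_eq_True)
    then show "poly_approximable ?E G"
      unfolding G_def p
      by (intro poly_approximable_mult poly_approximable_power poly_approximable_id E(1))
    fix z assume z: "z \<in> ?E"
    have bound: "2 * x ^ M / s < e"
      using M s by (simp add: field_simps)
    show "dist (G z) (if norm z \<le> \<rho> then 0 else inverse z) < e"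
    proof (cases "norm z \<le> \<rho>")
      case True
      have "norm (G z) = norm z ^ M / norm (z ^ Suc M - of_real (s ^ Suc M))"
        unfolding G_def by (simp only: norm_mult norm_inverse norm_power divide_inverse)
      also have "\<dots> \<le> (s * x) ^ M / (s ^ Suc M / 2)"
        using True near[OF True] x s by (intro frac_le power_mono) auto
      also have "\<dots> = 2 * x ^ M / s"
        using s by (simp add: power_mult_distrib)
      finally show ?thesis
        using True bound by simp
    next
      case False
      then have z': "norm z = r"
        using z K by auto
      then have "z \<noteq> 0"
        using s by auto
      then have "G z - inverse z = of_real (s ^ Suc M) / (z * (z ^ Suc M - of_real (s ^ Suc M)))"
        using nz[OF z] by (simp add: G_def divide_simps)
      then have "norm (G z - inverse z) = s ^ Suc M / (r * norm (z ^ Suc M - of_real (s ^ Suc M)))"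
        using s z' by (simp only: norm_divide norm_mult norm_of_real) simp
      also have "\<dots> \<le> (r * x) ^ Suc M / (r * (r ^ Suc M / 2))"
        using far[OF z'] x s by (intro frac_le power_mono mult_left_mono) auto
      also have "\<dots> = 2 * x ^ Suc M / r"
        using s by (simp add: power_mult_distrib)
      also have "\<dots> \<le> 2 * x ^ M / s"
        using xS s x by (intro frac_le mult_left_mono) auto
      finally show ?thesis
        using False bound by (simp add: dist_norm)
    qed
  qed
qed

text \<open>The functions that can be approximated on \<open>K\<close> simultaneously with 0 on the
  disc form an algebra. It contains \<open>inverse\<close>, hence the constants and
  \<open>z\<close>, and also \<open>cnj\<close>, which on the circle is a multiple of
  \<open>inverse\<close>. The real and imaginary parts then separate points, and Stone-Weierstrass
  applies.\<close>

lemma poly_approximable_zero_continuous: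
  fixes K :: "complex set"
  assumes \<rho>: "0 \<le> \<rho>" "\<rho> < r" and K: "compact K" "K \<subseteq> sphere 0 r" "K \<noteq> sphere 0 r"
    and f: "continuous_on K f"
  shows "poly_approximable (cball 0 \<rho> \<union> K) (\<lambda>z. if norm z \<le> \<rho> then 0 else f z)"
proof -
  let ?E = "cball 0 \<rho> \<union> K"
  define A where "A f \<longleftrightarrow> poly_approximable ?E (\<lambda>z. if norm z \<le> \<rho> then 0 else f z)"
    for f :: "complex \<Rightarrow> complex"
  have E: "compact ?E"
    using K by (intro compact_Un) auto
  have cong: "A f \<longleftrightarrow> A g" if "\<And>z. z \<in> K \<Longrightarrow> f z = g z" for f g
    unfolding A_def using that by (intro poly_approximable_cong) auto
  have add: "A (\<lambda>z. f z + g z)" if "A f" "A g" for f g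
    using poly_approximable_add[OF that[unfolded A_def]] unfolding A_def
    by (rule back_subst[where P = "poly_approximable ?E"]) auto
  \<comment> \<open>An ideal property: the first factor need not be small on the disc.\<close>
  have mult: "A (\<lambda>z. f z * g z)" if "poly_approximable ?E f" "A g" for f g
    using poly_approximable_mult[OF that(1) that(2)[unfolded A_def] E] unfolding A_def
    by (rule back_subst[where P = "poly_approximable ?E"]) auto
  have mult': "A (\<lambda>z. f z * g z)" if "A f" "A g" for f g
    using poly_approximable_mult[OF that[unfolded A_def] E] unfolding A_def
    by (rule back_subst[where P = "poly_approximable ?E"]) auto
  have inv: "A inverse"
    unfolding A_def by (rule poly_approximable_zero_inverse[OF \<rho> K])
  have nz: "norm z = r" "z \<noteq> 0" if "z \<in> K" for z
    using that K \<rho> by auto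
  have one: "A (\<lambda>_. 1)"
    \<comment> \<open>Multiplying the cut-off \<open>inverse z\<close> by \<open>z\<close> gives the
      function that is 1 on \<open>K\<close> and 0 on the disc.\<close>
    using mult[OF poly_approximable_id inv] nz by (subst cong[where g = "\<lambda>z. z * inverse z"]) auto
  have const: "A (\<lambda>_. c)" for c
    using mult[OF poly_approximable_const one] by simp
  have id: "A (\<lambda>z. z)"
    using mult[OF poly_approximable_id one] by simp
  have cnj: "A cnj"
  proof -
    have "cnj z = of_real (r\<^sup>2) * inverse z" if "z \<in> K" for z
      using nz[OF that] complex_norm_square[of z] by (simp add: field_simps)
    then show ?thesis
      using mult[OF poly_approximable_const inv] cong by metis
  qed
  have Re: "A (\<lambda>z. of_real (Re z))"
    using mult'[OF const[of "1 / 2"] add[OF id cnj]]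
    by (rule back_subst[where P = A]) (auto simp: complex_eq_iff)
  have Im: "A (\<lambda>z. of_real (Im z))"
    using mult'[OF const[of "- \<i> / 2"] add[OF id mult'[OF const[of "-1"] cnj]]]
    by (rule back_subst[where P = A]) (auto simp: complex_eq_iff)
  have real: "A (\<lambda>z. of_real (h z))" if h: "continuous_on K h" for h :: "complex \<Rightarrow> real"
    unfolding A_def
  proof (rule poly_approximable_limit)
    fix e :: real assume "e > 0"
    have "\<exists>g. (continuous_on K g \<and> A (\<lambda>z. of_real (g z))) \<and> (\<forall>z\<in>K. \<bar>h z - g z\<bar> < e)"
    proof (rule Stone_Weierstrass_HOL[OF K(1) _ _ _ _ _ h \<open>e > 0\<close>])
      fix z w :: complex assume "z \<in> K \<and> w \<in> K \<and> z \<noteq> w"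
      then have "Re z \<noteq> Re w \<or> Im z \<noteq> Im w"
        by (simp add: complex_eq_iff)
      then show "\<exists>g. (continuous_on K g \<and> A (\<lambda>z. of_real (g z))) \<and> g z \<noteq> g w"
        using Re Im continuous_on_Re[OF continuous_on_id] continuous_on_Im[OF continuous_on_id] by blast
    qed (auto intro: continuous_intros simp: const add mult')
    then obtain g where g: "A (\<lambda>z. of_real (g z))" "\<forall>z\<in>K. \<bar>h z - g z\<bar> < e"
      by blast
    have "dist (complex_of_real (g z)) (of_real (h z)) < e" if "z \<in> K" for z
      using g(2) that by (simp add: dist_real_def abs_minus_commute)
    with g show "\<exists>g. poly_approximable ?E g \<and>
        (\<forall>z\<in>?E. dist (g z) (if norm z \<le> \<rho> then 0 else of_real (h z)) < e)"
      using \<open>e > 0\<close> unfolding A_def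
      by (intro exI[of _ "\<lambda>z. if norm z \<le> \<rho> then 0 else complex_of_real (g z)"]) auto
  qed
  have "A (\<lambda>z. of_real (Re (f z)) + \<i> * of_real (Im (f z)))"
    using f by (intro add mult' const real continuous_intros)
  then have "A f"
    by (rule back_subst[where P = A]) (auto simp: complex_eq_iff)
  then show ?thesis
    by (simp add: A_def)
qed

text \<open>One step of the construction of the f_j: to \<open>p\<close> is added a polynomial that
  is nearly 0 on the disc and nearly the gap between the target and \<open>p\<close> on the copy of
  \<open>K\<close> of radius \<open>r\<close>.\<close>

lemma poly_perturb_on_circle:
  fixes K :: "complex set"
  assumes \<rho>: "0 \<le> \<rho>" "\<rho> < r" and K: "compact K" "K \<subseteq> sphere 0 1" "K \<noteq> sphere 0 1"
    and f: "continuous_on K f" and "e > 0"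
  obtains q where "\<And>z. norm z \<le> \<rho> \<Longrightarrow> dist (poly q z) (poly p z) < e"
    "\<And>\<zeta>. \<zeta> \<in> K \<Longrightarrow> dist (poly q (of_real r * \<zeta>)) (f \<zeta>) < e"
proof -
  have "r > 0" using \<rho> by simp
  define L where "L = (\<lambda>\<zeta>. complex_of_real r * \<zeta>) ` K"
  have L: "compact L" "L \<subseteq> sphere 0 r"
    using K \<open>r > 0\<close> unfolding L_def
    by (auto intro!: compact_continuous_image continuous_intros simp: norm_mult)
  have "\<exists>w\<in>sphere 0 1. w \<notin> K"
    using K by blast
  then obtain w where w: "norm w = 1" "w \<notin> K"
    by auto
  then have "of_real r * w \<in> sphere 0 r - L"
    using \<open>r > 0\<close> by (auto simp: L_def norm_mult)
  then have "L \<noteq> sphere 0 r"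
    by blast
  moreover have "continuous_on L (\<lambda>z. f (z / of_real r) - poly p z)"
    using \<open>r > 0\<close>
    by (intro continuous_intros continuous_on_compose2[OF f]) (auto simp: L_def)
  ultimately have "poly_approximable (cball 0 \<rho> \<union> L)
      (\<lambda>z. if norm z \<le> \<rho> then 0 else f (z / of_real r) - poly p z)"
    using L by (intro poly_approximable_zero_continuous[OF \<rho>])
  then obtain q where q: "\<And>z. z \<in> cball 0 \<rho> \<union> L \<Longrightarrow>
      dist (poly q z) (if norm z \<le> \<rho> then 0 else f (z / of_real r) - poly p z) < e"
    using poly_approximableD \<open>e > 0\<close> by blast
  show thesis
  proof (rule that[of "p + q"])
    show "dist (poly (p + q) z) (poly p z) < e" if "norm z \<le> \<rho>" for z
      using q[of z] that by (simp add: dist_norm)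
    show "dist (poly (p + q) (of_real r * \<zeta>)) (f \<zeta>) < e" if \<zeta>: "\<zeta> \<in> K" for \<zeta>
    proof -
      have "\<not> norm (of_real r * \<zeta>) \<le> \<rho>" "of_real r * \<zeta> \<in> L"
        using K \<rho> \<zeta> by (auto simp: L_def norm_mult)
      then show ?thesis
        using q[of "of_real r * \<zeta>"] \<open>r > 0\<close> by (simp add: dist_norm algebra_simps)
    qed
  qed
qed

lemma polynomials_dense_on_circle_part:
  fixes K :: "complex set"
  assumes K: "compact K" "K \<subseteq> sphere 0 1" "K \<noteq> sphere 0 1"
    and f: "continuous_on K f" and "e > 0"
  obtains q where "\<And>\<zeta>. \<zeta> \<in> K \<Longrightarrow> dist (poly q \<zeta>) (f \<zeta>) < e"
  by (rule poly_perturb_on_circle[of 0 1 K f e 0, OF _ _ K f \<open>e > 0\<close>]) (use that in auto)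

text \<open>The polynomials \<open>S k\<close> change by less than \<open>(1 / 2) ^ k\<close> on the
  disc of radius \<open>R k\<close>, hence converge locally uniformly. Target \<open>k\<close> is
  met on the next circle, of radius \<open>R (Suc k)\<close>, which lies outside the protected disc
  but inside all later ones.\<close>

lemma holomorphic_approximating_on_circles:
  fixes R :: "nat \<Rightarrow> real" and K :: "nat \<Rightarrow> complex set"
  assumes R: "strict_mono R" "\<And>k. R k \<in> {0..<1}" "R \<longlonglongrightarrow> 1"
    and K: "\<And>k. compact (K k)" "\<And>k. K k \<subseteq> sphere 0 1" "\<And>k. K k \<noteq> sphere 0 1"
    and T: "\<And>k. continuous_on (K k) (T k)"
  obtains f where "f holomorphic_on ball 0 1"
    "\<And>k \<zeta>. \<zeta> \<in> K k \<Longrightarrow> dist (f (of_real (R (Suc k)) * \<zeta>)) (T k \<zeta>) \<le> 2 * (1 / 2) ^ k"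
proof -
  have "\<exists>S. \<forall>k. True \<and> ((\<forall>z. norm z \<le> R k \<longrightarrow> dist (poly (S (Suc k)) z) (poly (S k) z) < (1 / 2) ^ k)
      \<and> (\<forall>\<zeta>\<in>K k. dist (poly (S (Suc k)) (of_real (R (Suc k)) * \<zeta>)) (T k \<zeta>) < (1 / 2) ^ k))"
  proof (rule dependent_nat_choice)
    fix p :: "complex poly" and k :: nat
    have "0 \<le> R k" and "R k < R (Suc k)"
      using R(2)[of k] R(1) by (auto simp: strict_mono_Suc_iff)
    then obtain q where "\<And>z. norm z \<le> R k \<Longrightarrow> dist (poly q z) (poly p z) < (1 / 2) ^ k"
        "\<And>\<zeta>. \<zeta> \<in> K k \<Longrightarrow> dist (poly q (of_real (R (Suc k)) * \<zeta>)) (T k \<zeta>) < (1 / 2) ^ k"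
      using poly_perturb_on_circle[OF _ _ K[of k] T[of k], of "R k" "R (Suc k)" "(1 / 2) ^ k" p]
      by auto
    then show "\<exists>q. True \<and> ((\<forall>z. norm z \<le> R k \<longrightarrow> dist (poly q z) (poly p z) < (1 / 2) ^ k)
        \<and> (\<forall>\<zeta>\<in>K k. dist (poly q (of_real (R (Suc k)) * \<zeta>)) (T k \<zeta>) < (1 / 2) ^ k))"
      by blast
  qed simp
  then obtain S where S:
      "\<And>k z. norm z \<le> R k \<Longrightarrow> dist (poly (S (Suc k)) z) (poly (S k) z) < (1 / 2) ^ k"
      "\<And>k \<zeta>. \<zeta> \<in> K k \<Longrightarrow> dist (poly (S (Suc k)) (of_real (R (Suc k)) * \<zeta>)) (T k \<zeta>) < (1 / 2) ^ k"
    by blast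
  define g where "g k z = poly (S k) z" for k z
  have tail: "dist (g m z) (g n z) \<le> 2 * (1 / 2) ^ n" if "norm z \<le> R n" "n \<le> m" for m n z
  proof -
    \<comment> \<open>The subtracted term is what is left of the geometric series; with it the
      induction closes.\<close>
    have "dist (g m z) (g n z) \<le> 2 * (1 / 2) ^ n - 2 * (1 / 2) ^ m"
      using that(2)
    proof (induction rule: dec_induct)
      case (step m)
      have "R n \<le> R m"
        using R(1) step(1) by (simp add: strict_mono_less_eq)
      then have "dist (g (Suc m) z) (g m z) \<le> (1 / 2) ^ m"
        using S(1)[of z m] that(1) by (simp add: g_def)
      then show ?case
        using step.IH dist_triangle[of "g (Suc m) z" "g n z" "g m z"] by simp
    qed simp
    then show ?thesis
      by (smt (verit) zero_le_power divide_nonneg_nonneg)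
  qed
  have small: "(\<lambda>n. 2 * (1 / 2) ^ n :: real) \<longlonglongrightarrow> 0"
    using tendsto_mult[OF tendsto_const LIMSEQ_power_zero[of "1 / 2 :: real"]] by simp
  have conv: "convergent (\<lambda>m. g m z)" if z: "norm z \<le> R k" for z k
    unfolding Cauchy_convergent_iff[symmetric] Cauchy_altdef2
  proof (intro allI impI)
    fix e :: real assume "e > 0"
    then have "eventually (\<lambda>n. 2 * (1 / 2) ^ n < e) sequentially"
      using order_tendstoD(2)[OF small] by blast
    then obtain N where N: "N \<ge> k" "2 * (1 / 2) ^ N < e"
      using eventually_happens[OF eventually_conj[OF _ eventually_ge_at_top[of k]]] by auto
    have "R k \<le> R N"
      using R(1) N(1) by (simp add: strict_mono_less_eq)
    then show "\<exists>N. \<forall>n\<ge>N. dist (g n z) (g N z) < e"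
      using tail[of z N] z N(2) by (meson order_trans le_less_trans)
  qed
  define f where "f z = lim (\<lambda>m. g m z)" for z
  have near: "dist (f z) (g n z) \<le> 2 * (1 / 2) ^ n" if z: "norm z \<le> R n" for n z
  proof (rule tendsto_upperbound)
    show "(\<lambda>m. dist (g m z) (g n z)) \<longlonglongrightarrow> dist (f z) (g n z)"
      unfolding f_def using conv[OF z] by (intro tendsto_intros) (simp add: convergent_LIMSEQ_iff)
    show "eventually (\<lambda>m. dist (g m z) (g n z) \<le> 2 * (1 / 2) ^ n) sequentially"
      using eventually_ge_at_top[of n] by eventually_elim (rule tail[OF z])
  qed simp
  have "f holomorphic_on ball 0 1"
  proof (rule holomorphic_uniform_sequence[where f = g])
    show "g n holomorphic_on ball 0 1" for n
      unfolding g_def by (intro holomorphic_intros)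
    fix x :: complex assume "x \<in> ball 0 1"
    define d where "d = (1 - norm x) / 2"
    have d: "d > 0" "norm x + d < 1"
      using \<open>x \<in> ball 0 1\<close> by (auto simp: d_def field_simps)
    then obtain k where k: "norm x + d < R k"
      using eventually_happens[OF order_tendstoD(1)[OF R(3)]] by auto
    have in_cball: "norm z \<le> R n" if "z \<in> cball x d" "k \<le> n" for z n
    proof -
      have "norm z \<le> norm x + d"
        using that(1) norm_triangle_ineq2[of z x] by (simp add: dist_norm norm_minus_commute)
      moreover have "R k \<le> R n"
        using R(1) that(2) by (simp add: strict_mono_less_eq)
      ultimately show ?thesis using k by simp
    qed
    have "uniform_limit (cball x d) g f sequentially"
    proof (rule uniform_limitI)
      fix e :: real assume "e > 0"
      then have "eventually (\<lambda>n. 2 * (1 / 2) ^ n < e) sequentially"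
        using order_tendstoD(2)[OF small] by blast
      then show "eventually (\<lambda>n. \<forall>z\<in>cball x d. dist (g n z) (f z) < e) sequentially"
        using eventually_ge_at_top[of k]
      proof eventually_elim
        case (elim n)
        show ?case
        proof
          fix z assume "z \<in> cball x d"
          then show "dist (g n z) (f z) < e"
            using near[OF in_cball, of z n] elim by (simp add: dist_commute)
        qed
      qed
    qed
    moreover have "cball x d \<subseteq> ball 0 1"
    proof
      fix z assume "z \<in> cball x d"
      then show "z \<in> ball 0 1"
        using in_cball[of z k] R(2)[of k] by auto
    qed
    ultimately show "\<exists>d>0. cball x d \<subseteq> ball 0 1 \<and> uniform_limit (cball x d) g f sequentially"
      using d(1) by blast
  qed simp
  moreover have "dist (f (of_real (R (Suc k)) * \<zeta>)) (T k \<zeta>) \<le> 2 * (1 / 2) ^ k"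
    if \<zeta>: "\<zeta> \<in> K k" for k \<zeta>
  proof -
    have "norm (of_real (R (Suc k)) * \<zeta>) \<le> R (Suc k)"
      using K(2)[of k] \<zeta> R(2)[of "Suc k"] by (auto simp: norm_mult)
    \<comment> \<open>The later corrections contribute \<open>2 * (1 / 2) ^ Suc k\<close>, which is
      \<open>(1 / 2) ^ k\<close>, and meeting the target contributes another
      \<open>(1 / 2) ^ k\<close>.\<close>
    from near[OF this] S(2)[OF \<zeta>] show ?thesis
      using dist_triangle[of "f (of_real (R (Suc k)) * \<zeta>)" "T k \<zeta>" "g (Suc k) (of_real (R (Suc k)) * \<zeta>)"]
      by (simp add: g_def)
  qed
  ultimately show thesis
    using that by blast
qed

section \<open>Approximate lifting on a part of the circle\<close>

text \<open>Cutting the circle at a point \<open>\<omega>\<close> outside \<open>K\<close> turns it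
  into a path over the unit interval, to which path lifting applies; an angle function pulls the
  lift back to \<open>K\<close>.\<close>

lemma poly_circle_lift_approx:
  fixes p :: "complex poly" and K :: "complex set"
  assumes deg: "degree p > 0" and K: "compact K" "K \<subseteq> sphere 0 1" "K \<noteq> sphere 0 1"
    and f: "continuous_on K f" and "e > 0"
  obtains h where "continuous_on K h" "\<And>\<zeta>. \<zeta> \<in> K \<Longrightarrow> dist (poly p (h \<zeta>)) (f \<zeta>) < e"
proof -
  have "\<exists>\<omega>\<in>sphere 0 1. \<omega> \<notin> K"
    using K by blast
  then obtain \<omega> where \<omega>: "norm \<omega> = 1" "\<omega> \<notin> K"
    by auto
  \<comment> \<open>The function \<open>f\<close> lives on \<open>K\<close> only, while path lifting
    wants a whole interval. A polynomial close to \<open>f\<close> is defined on the entire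
    circle.\<close>
  obtain q where q: "\<And>\<zeta>. \<zeta> \<in> K \<Longrightarrow> dist (poly q \<zeta>) (f \<zeta>) < e / 2"
    using polynomials_dense_on_circle_part[OF K f, of "e / 2"] \<open>e > 0\<close> half_gt_zero by blast
  have "continuous_on {0..1} (\<lambda>t. poly q (- \<omega> * cis (pi * (2 * t - 1))))"
    by (intro continuous_intros)
  then obtain g where g: "continuous_on {0..1} g"
      "\<And>t. t \<in> {0..1} \<Longrightarrow> dist (poly p (g t)) (poly q (- \<omega> * cis (pi * (2 * t - 1)))) < e / 2"
    using poly_path_lift_approx[OF deg, of _ "e / 2"] half_gt_zero[OF \<open>e > 0\<close>] by blast
  \<comment> \<open>The angle is measured from \<open>- \<omega>\<close>, so that the branch cut of
    \<open>Ln\<close> is hit only at \<open>\<omega>\<close>, which is not in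
    \<open>K\<close>.\<close>
  define \<theta> where "\<theta> \<zeta> = Im (Ln (- \<zeta> / \<omega>))" for \<zeta>
  have slit: "- \<zeta> / \<omega> \<notin> \<real>\<^sub>\<le>\<^sub>0" and nz: "- \<zeta> / \<omega> \<noteq> 0" if \<zeta>: "\<zeta> \<in> K" for \<zeta>
  proof -
    have n1: "norm (- \<zeta> / \<omega>) = 1"
      using \<zeta> K \<omega> by (auto simp: norm_divide)
    then show "- \<zeta> / \<omega> \<noteq> 0"
      by (metis norm_zero zero_neq_one)
    show "- \<zeta> / \<omega> \<notin> \<real>\<^sub>\<le>\<^sub>0"
    proof
      assume "- \<zeta> / \<omega> \<in> \<real>\<^sub>\<le>\<^sub>0"
      then obtain x where x: "- \<zeta> / \<omega> = of_real x" "x \<le> 0"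
        by (elim nonpos_Reals_cases)
      then have "x = -1"
        using n1 unfolding x(1) by simp
      with x have "- \<zeta> / \<omega> = -1"
        by simp
      then have "\<zeta> = \<omega>"
        using \<omega>(1) by (auto simp: divide_eq_eq split: if_splits)
      with \<zeta> \<omega> show False by simp
    qed
  qed
  have cis_\<theta>: "- \<omega> * cis (\<theta> \<zeta>) = \<zeta>" if \<zeta>: "\<zeta> \<in> K" for \<zeta>
  proof -
    have "norm (- \<zeta> / \<omega>) = 1"
      using \<zeta> K \<omega> by (auto simp: norm_divide)
    then have "Ln (- \<zeta> / \<omega>) = \<i> * of_real (\<theta> \<zeta>)"
      using Re_Ln[OF nz[OF \<zeta>]] by (simp add: complex_eq_iff \<theta>_def)
    then have "cis (\<theta> \<zeta>) = - \<zeta> / \<omega>"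
      using exp_Ln[OF nz[OF \<zeta>]] by (simp add: cis_conv_exp)
    then show ?thesis
      using \<omega>(1) by (auto simp: field_simps)
  qed
  define t where "t \<zeta> = (\<theta> \<zeta> / pi + 1) / 2" for \<zeta>
  have t: "t \<zeta> \<in> {0..1}" if "\<zeta> \<in> K" for \<zeta>
    using mpi_less_Im_Ln[OF nz[OF that]] Im_Ln_le_pi[OF nz[OF that]]
    by (auto simp: t_def \<theta>_def field_simps)
  have "continuous_on K t"
    unfolding t_def \<theta>_def using slit \<omega> by (intro continuous_intros) auto
  then have "continuous_on K (\<lambda>\<zeta>. g (t \<zeta>))"
    using t by (intro continuous_on_compose2[OF g(1)]) auto
  moreover have "dist (poly p (g (t \<zeta>))) (f \<zeta>) < e" if \<zeta>: "\<zeta> \<in> K" for \<zeta>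
  proof -
    have "pi * (2 * t \<zeta> - 1) = \<theta> \<zeta>"
      by (simp add: t_def field_simps)
    then have "dist (poly p (g (t \<zeta>))) (poly q \<zeta>) < e / 2"
      using g(2)[OF t[OF \<zeta>]] cis_\<theta>[OF \<zeta>] by metis
    then show ?thesis
      using q[OF \<zeta>] dist_triangle_half_r[of "poly q \<zeta>" "poly p (g (t \<zeta>))" e "f \<zeta>"]
      by (simp add: dist_commute)
  qed
  ultimately show thesis
    using that by blast
qed

section \<open>Polynomials with rational coefficients\<close>

definition rat_complex :: "rat \<times> rat \<Rightarrow> complex" where
  "rat_complex = (\<lambda>(a, b). Complex (of_rat a) (of_rat b))"

text \<open>Coefficient lists over pairs of rationals form a countable type, so these polynomials
  can be enumerated through \<open>from_nat\<close>.\<close>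

definition rat_poly :: "(rat \<times> rat) list \<Rightarrow> complex poly" where
  "rat_poly xs = Poly (map rat_complex xs)"

lemma rat_complex_dense:
  assumes "e > 0"
  obtains c where "dist (rat_complex c) z < e"
proof -
  obtain a b where ab: "Re z < of_rat a" "of_rat a < Re z + e / 2"
      "Im z < of_rat b" "of_rat b < Im z + e / 2"
    using of_rat_dense[of "Re z" "Re z + e / 2"] of_rat_dense[of "Im z" "Im z + e / 2"] assms
    by auto
  have "norm (rat_complex (a, b) - z) < e"
    using cmod_le[of "rat_complex (a, b) - z"] ab by (simp add: rat_complex_def)
  then show thesis
    using that by (simp add: dist_norm)
qed

text \<open>On the closed unit disc multiplication by \<open>z\<close> does not increase distances,
  so in Horner form the constant coefficient and the remaining polynomial may each use up half of
  the error.\<close>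

lemma rat_poly_dense:
  assumes "e > 0"
  obtains xs where "\<And>z. norm z \<le> 1 \<Longrightarrow> dist (poly (rat_poly xs) z) (poly p z) < e"
proof -
  have "\<exists>xs. \<forall>z. norm z \<le> 1 \<longrightarrow> dist (poly (rat_poly xs) z) (poly p z) < e"
    using assms
  proof (induction p arbitrary: e)
    case 0
    then show ?case
      by (intro exI[of _ "[]"]) (simp add: rat_poly_def)
  next
    case (pCons a p)
    obtain c where c: "dist (rat_complex c) a < e / 2"
      using rat_complex_dense pCons.prems half_gt_zero by blast
    obtain xs where xs: "\<And>z. norm z \<le> 1 \<Longrightarrow> dist (poly (rat_poly xs) z) (poly p z) < e / 2"
      using pCons.IH pCons.prems half_gt_zero by blast
    have "dist (poly (rat_poly (c # xs)) z) (poly (pCons a p) z) < e" if z: "norm z \<le> 1" for z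
    proof -
      have "dist (z * poly (rat_poly xs) z) (z * poly p z) = norm z * dist (poly (rat_poly xs) z) (poly p z)"
        by (simp add: dist_norm norm_mult flip: right_diff_distrib)
      also have "\<dots> \<le> dist (poly (rat_poly xs) z) (poly p z)"
        using z by (simp add: mult_left_le_one_le)
      also have "\<dots> < e / 2"
        by (rule xs[OF z])
      finally show ?thesis
        using c dist_triangle_add[of "rat_complex c" "z * poly (rat_poly xs) z" a "z * poly p z"]
        by (simp add: rat_poly_def)
    qed
    then show ?case by blast
  qed
  then show thesis
    using that by blast
qed

lemma rat_poly_circle_lift_approx:
  fixes p :: "complex poly" and K :: "complex set"
  assumes deg: "degree p > 0" and K: "compact K" "K \<subseteq> sphere 0 1" "K \<noteq> sphere 0 1"
    and f: "continuous_on K f" and "e > 0"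
  obtains xs where "\<And>\<zeta>. \<zeta> \<in> K \<Longrightarrow> dist (poly p (poly (rat_poly xs) \<zeta>)) (f \<zeta>) < e"
proof -
  obtain h where h: "continuous_on K h" "\<And>\<zeta>. \<zeta> \<in> K \<Longrightarrow> dist (poly p (h \<zeta>)) (f \<zeta>) < e / 2"
    using poly_circle_lift_approx[OF deg K f, of "e / 2"] \<open>e > 0\<close> by auto
  have "compact (h ` K)"
    by (intro compact_continuous_image h K)
  then obtain B where "\<forall>\<zeta>\<in>K. norm (h \<zeta>) \<le> B"
    by (auto dest!: compact_imp_bounded simp: bounded_iff)
  then have B: "norm (h \<zeta>) \<le> B" if "\<zeta> \<in> K" for \<zeta>
    using that by blast
  \<comment> \<open>The extra 1 leaves room for the approximants of \<open>h\<close>; the two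
    approximation errors below add up to at most 1 and at most \<open>d\<close>.\<close>
  have "uniformly_continuous_on (cball 0 (B + 1)) (poly p)"
    by (intro compact_uniformly_continuous continuous_intros) auto
  then obtain d where d: "d > 0" "\<And>z w. z \<in> cball 0 (B + 1) \<Longrightarrow> w \<in> cball 0 (B + 1) \<Longrightarrow>
      dist w z < d \<Longrightarrow> dist (poly p w) (poly p z) < e / 2"
    using \<open>e > 0\<close> unfolding uniformly_continuous_on_def by (meson half_gt_zero)
  define d' where "d' = min d 1 / 2"
  have d': "d' > 0" "d' + d' \<le> d" "d' + d' \<le> 1"
    using d(1) by (auto simp: d'_def)
  obtain q where q: "\<And>\<zeta>. \<zeta> \<in> K \<Longrightarrow> dist (poly q \<zeta>) (h \<zeta>) < d'"
    using polynomials_dense_on_circle_part[OF K h(1) d'(1)] by blast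
  obtain xs where xs: "\<And>z. norm z \<le> 1 \<Longrightarrow> dist (poly (rat_poly xs) z) (poly q z) < d'"
    using rat_poly_dense[OF d'(1)] by blast
  show thesis
  proof (rule that[of xs])
    fix \<zeta> assume \<zeta>: "\<zeta> \<in> K"
    then have "norm \<zeta> \<le> 1"
      using K by auto
    then have "dist (poly (rat_poly xs) \<zeta>) (h \<zeta>) < d' + d'"
      using xs[of \<zeta>] q[OF \<zeta>] dist_triangle[of "poly (rat_poly xs) \<zeta>" "h \<zeta>" "poly q \<zeta>"] by simp
    moreover from this have "norm (poly (rat_poly xs) \<zeta>) \<le> B + 1"
      using B[OF \<zeta>] d' norm_triangle_ineq2[of "poly (rat_poly xs) \<zeta>" "h \<zeta>"] by (simp add: dist_norm)
    ultimately have "dist (poly p (poly (rat_poly xs) \<zeta>)) (poly p (h \<zeta>)) < e / 2"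
      using B[OF \<zeta>] d' by (intro d(2)) auto
    then show "dist (poly p (poly (rat_poly xs) \<zeta>)) (f \<zeta>) < e"
      using h(2)[OF \<zeta>] dist_triangle[of "poly p (poly (rat_poly xs) \<zeta>)" "f \<zeta>" "poly p (h \<zeta>)"]
      by simp
  qed
qed

section \<open>Joint universality\<close>

text \<open>The exponents \<open>d ^ j\<close> make the first \<open>N\<close> functions approximate a Kronecker substitution:
  a polynomial in them then approximates a polynomial in one variable, evaluated at a function that
  is still free to choose.\<close>

definition circle_universal :: "(nat \<Rightarrow> real) \<Rightarrow> (nat \<Rightarrow> disc_hol) \<Rightarrow> bool" where
  "circle_universal r F \<longleftrightarrow>
     (\<forall>K xs d. compact K \<and> K \<subseteq> sphere 0 1 \<and> K \<noteq> sphere 0 1 \<longrightarrow>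
        (\<exists>n :: nat \<Rightarrow> nat. filterlim n at_top sequentially \<and>
           (\<forall>j. uniform_limit K (\<lambda>i \<zeta>. hol_fun (F j) (of_real (r (n i)) * \<zeta>))
                  (\<lambda>\<zeta>. poly (rat_poly xs) \<zeta> ^ (d ^ j)) sequentially)))"

lemma inj_imp_filterlim_at_top:
  fixes f :: "nat \<Rightarrow> nat"
  assumes "inj f"
  shows "filterlim f at_top sequentially"
  unfolding filterlim_at_top
proof
  fix Z
  have "finite (f -` {..<Z})"
    using assms by (intro finite_vimageI) auto
  then show "eventually (\<lambda>i. Z \<le> f i) sequentially"
    by (simp add: eventually_cofinite not_le vimage_def flip: cofinite_eq_sequentially)
qed

text \<open>Every compact proper part of the circle avoids a ball with rational data that meets the
  circle, so countably many arcs suffice. A task consists of an arc, a rational polynomial and a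
  base \<open>d\<close>. The index \<open>j\<close> is not part of it: all functions serve the same
  task on the same circle, which makes the universality joint.\<close>

lemma exists_circle_universal:
  assumes r: "incseq r" "\<And>n. r n \<in> {0..<1}" "r \<longlonglongrightarrow> 1"
  obtains F where "circle_universal r F"
proof -
  \<comment> \<open>The radii may repeat. Since they tend to 1 and stay below it, a subsequence is
    strictly increasing.\<close>
  have "\<exists>\<nu>. \<forall>k. True \<and> (\<nu> k < \<nu> (Suc k) \<and> r (\<nu> k) < r (\<nu> (Suc k)))"
  proof (rule dependent_nat_choice)
    fix x k :: nat
    have "eventually (\<lambda>y. r x < r y) sequentially"
      using order_tendstoD(1)[OF r(3)] r(2)[of x] by simp
    from eventually_conj[OF this eventually_gt_at_top[of x]]
    show "\<exists>y. True \<and> (x < y \<and> r x < r y)"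
      by (auto simp: eventually_sequentially)
  qed simp
  then obtain \<nu> where \<nu>: "\<And>k. \<nu> k < \<nu> (Suc k)" "\<And>k. r (\<nu> k) < r (\<nu> (Suc k))"
    by blast
  have "strict_mono \<nu>"
    using \<nu>(1) by (simp add: strict_mono_Suc_iff)
  define R where "R k = r (\<nu> k)" for k
  have R: "strict_mono R" "\<And>k. R k \<in> {0..<1}" "R \<longlonglongrightarrow> 1"
    using \<nu>(2) r(2) LIMSEQ_subseq_LIMSEQ[OF r(3) \<open>strict_mono \<nu>\<close>]
    by (auto simp: R_def[abs_def] strict_mono_Suc_iff o_def)
  \<comment> \<open>The first component \<open>i\<close> has no meaning of its own: it makes every
    task \<open>(c, s, d, xs)\<close> occur infinitely often.\<close>
  define code :: "nat \<Rightarrow> nat \<times> (rat \<times> rat) \<times> rat \<times> nat \<times> (rat \<times> rat) list"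
    where "code = from_nat"
  define arc where "arc c s = sphere 0 1 - ball (rat_complex c) (of_rat s)" for c s
  \<comment> \<open>If the ball misses the circle, nothing is removed and the arc is not proper; the
    empty set stands in for it.\<close>
  define K where "K k = (case code k of (i, c, s, d, xs) \<Rightarrow>
    if arc c s = sphere 0 1 then {} else arc c s)" for k
  define T where "T j k = (case code k of (i, c, s, d, xs) \<Rightarrow> \<lambda>\<zeta>. poly (rat_poly xs) \<zeta> ^ (d ^ j))"
    for j k
  have "(1::complex) \<in> sphere 0 1" by simp
  then have ne: "{} \<noteq> sphere (0::complex) 1" by blast
  have K: "compact (K k)" "K k \<subseteq> sphere 0 1" "K k \<noteq> sphere 0 1" for k
    using ne by (auto simp: K_def arc_def compact_diff split: prod.splits)
  have T: "continuous_on (K k) (T j k)" for j k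
    by (auto simp: T_def split: prod.splits intro!: continuous_intros)
  have "\<exists>f. \<forall>j. f j holomorphic_on ball 0 1 \<and>
      (\<forall>k. \<forall>\<zeta>\<in>K k. dist (f j (of_real (R (Suc k)) * \<zeta>)) (T j k \<zeta>) \<le> 2 * (1 / 2) ^ k)"
  proof (intro choice allI)
    fix j
    show "\<exists>f. f holomorphic_on ball 0 1 \<and>
      (\<forall>k. \<forall>\<zeta>\<in>K k. dist (f (of_real (R (Suc k)) * \<zeta>)) (T j k \<zeta>) \<le> 2 * (1 / 2) ^ k)"
      by (rule holomorphic_approximating_on_circles[where T = "T j", OF R K T]) blast
  qed
  then obtain f where f: "\<And>j. f j holomorphic_on ball 0 1"
      "\<And>j k \<zeta>. \<zeta> \<in> K k \<Longrightarrow> dist (f j (of_real (R (Suc k)) * \<zeta>)) (T j k \<zeta>) \<le> 2 * (1 / 2) ^ k"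
    by blast
  define F where "F j = to_disc_hol (f j)" for j
  have "circle_universal r F"
    unfolding circle_universal_def
  proof (intro allI impI)
    fix L :: "complex set" and xs :: "(rat \<times> rat) list" and d :: nat
    assume L: "compact L \<and> L \<subseteq> sphere 0 1 \<and> L \<noteq> sphere 0 1"
    then have "\<exists>\<omega>\<in>sphere 0 1. \<omega> \<notin> L"
      by blast
    then obtain \<omega> where \<omega>: "norm \<omega> = 1" "\<omega> \<in> - L"
      by auto
    have "open (- L)"
      using L compact_imp_closed by blast
    then obtain \<delta> where \<delta>: "\<delta> > 0" "ball \<omega> \<delta> \<subseteq> - L"
      using \<omega>(2) open_contains_ball by blast
    \<comment> \<open>A ball of radius \<open>s\<close> whose centre is closer than \<open>s\<close>
      to \<open>\<omega>\<close> contains \<open>\<omega>\<close>, and it stays within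
      \<open>\<delta>\<close> of \<open>\<omega>\<close>, hence off \<open>L\<close>.\<close>
    obtain s where s: "0 < (of_rat s :: real)" "of_rat s < \<delta> / 2"
      using of_rat_dense[of 0 "\<delta> / 2"] \<delta>(1) by auto
    obtain c where c: "dist (rat_complex c) \<omega> < of_rat s"
      using rat_complex_dense[OF s(1)] by blast
    have L_sub: "L \<subseteq> arc c s"
    proof
      fix z assume z: "z \<in> L"
      have "z \<notin> ball (rat_complex c) (of_rat s)"
      proof
        assume "z \<in> ball (rat_complex c) (of_rat s)"
        then have "dist \<omega> z < \<delta>"
          using c s(2) dist_triangle2[of \<omega> z "rat_complex c"] by (simp add: dist_commute)
        with \<delta>(2) z show False by auto
      qed
      with z L show "z \<in> arc c s"
        by (auto simp: arc_def)
    qed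
    have "\<omega> \<notin> arc c s" "\<omega> \<in> sphere 0 1"
      using \<omega> c by (auto simp: arc_def)
    then have arc: "arc c s \<noteq> sphere 0 1"
      by blast
    define k where "k i = to_nat (i :: nat, c, s, d, xs)" for i
    have code_k: "code (k i) = (i, c, s, d, xs)" for i
      by (simp add: code_def k_def)
    have k: "filterlim k at_top sequentially"
      by (rule inj_imp_filterlim_at_top) (auto simp: k_def inj_on_def)
    have small: "(\<lambda>i. 2 * (1 / 2) ^ k i :: real) \<longlonglongrightarrow> 0"
      using filterlim_compose[OF LIMSEQ_power_zero[of "1 / 2 :: real"] k]
      by (intro tendsto_mult_right_zero) (simp add: o_def)
    have "filterlim (\<lambda>i. \<nu> (Suc (k i))) at_top sequentially"
      by (intro filterlim_compose[OF filterlim_subseq[OF \<open>strict_mono \<nu>\<close>]]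
            filterlim_compose[OF filterlim_Suc] k)
    moreover have "uniform_limit L (\<lambda>i \<zeta>. hol_fun (F j) (of_real (r (\<nu> (Suc (k i)))) * \<zeta>))
        (\<lambda>\<zeta>. poly (rat_poly xs) \<zeta> ^ (d ^ j)) sequentially" for j
    proof (rule uniform_limitI)
      fix e :: real assume "e > 0"
      then have "eventually (\<lambda>i. 2 * (1 / 2) ^ k i < e) sequentially"
        using order_tendstoD(2)[OF small] by blast
      then show "eventually (\<lambda>i. \<forall>\<zeta>\<in>L. dist (hol_fun (F j) (of_real (r (\<nu> (Suc (k i)))) * \<zeta>))
          (poly (rat_poly xs) \<zeta> ^ (d ^ j)) < e) sequentially"
      proof eventually_elim
        case (elim i)
        show ?case
        proof
          fix \<zeta> assume \<zeta>: "\<zeta> \<in> L"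
          have "of_real (R (Suc (k i))) * \<zeta> \<in> ball 0 1"
            using R(2)[of "Suc (k i)"] \<zeta> L by (auto simp: norm_mult)
          moreover have "\<zeta> \<in> K (k i)"
            using \<zeta> L_sub arc by (auto simp: K_def code_k)
          ultimately show "dist (hol_fun (F j) (of_real (r (\<nu> (Suc (k i)))) * \<zeta>))
              (poly (rat_poly xs) \<zeta> ^ (d ^ j)) < e"
            using f(2)[of \<zeta> "k i" j] elim
            by (simp add: F_def hol_fun_to_disc_hol[OF f(1)] R_def T_def code_k)
        qed
      qed
    qed
    ultimately show "\<exists>n. filterlim n at_top sequentially \<and>
        (\<forall>j. uniform_limit L (\<lambda>i \<zeta>. hol_fun (F j) (of_real (r (n i)) * \<zeta>))
               (\<lambda>\<zeta>. poly (rat_poly xs) \<zeta> ^ (d ^ j)) sequentially)"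
      by (intro exI[of _ "\<lambda>i. \<nu> (Suc (k i))"]) blast
  qed
  then show thesis
    using that by blast
qed

text \<open>The strictly increasing sequence demanded by \<open>U_A\<close> is assembled
  recursively: the \<open>k\<close>-th index has tolerance \<open>1 / (k + 1)\<close>, and each
  index is taken beyond its predecessor.\<close>

lemma U_A_I:
  assumes "\<And>K \<phi> e N. compact K \<Longrightarrow> K \<subseteq> sphere 0 1 \<Longrightarrow> K \<noteq> sphere 0 1 \<Longrightarrow> continuous_on K \<phi> \<Longrightarrow> e > 0
    \<Longrightarrow> \<exists>n>N. \<forall>\<zeta>\<in>K. dist (hol_fun f (of_real (r n) * \<zeta>)) (\<phi> \<zeta>) < e"
  shows "f \<in> U_A r"
  unfolding U_A_def mem_Collect_eq SUP_ennreal_norm_tendsto_0_iff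
proof (intro allI impI)
  fix K :: "complex set" and \<phi> :: "complex \<Rightarrow> complex"
  assume K: "compact K \<and> K \<subseteq> sphere 0 1 \<and> K \<noteq> sphere 0 1 \<and> continuous_on K \<phi>"
  have "\<exists>n. \<forall>k. (\<forall>\<zeta>\<in>K. dist (hol_fun f (of_real (r (n k)) * \<zeta>)) (\<phi> \<zeta>) < inverse (Suc k)) \<and> n k < n (Suc k)"
  proof (rule dependent_nat_choice)
    show "\<exists>n. \<forall>\<zeta>\<in>K. dist (hol_fun f (of_real (r n) * \<zeta>)) (\<phi> \<zeta>) < inverse (Suc 0)"
      using assms[of K \<phi> "inverse (Suc 0)" 0] K by auto
    show "\<exists>n. (\<forall>\<zeta>\<in>K. dist (hol_fun f (of_real (r n) * \<zeta>)) (\<phi> \<zeta>) < inverse (Suc (Suc k))) \<and> N < n"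
      for N k :: nat
      using assms[of K \<phi> "inverse (Suc (Suc k))" N] K by (auto simp del: of_nat_Suc)
  qed
  then obtain n where n: "\<And>k \<zeta>. \<zeta> \<in> K \<Longrightarrow> dist (hol_fun f (of_real (r (n k)) * \<zeta>)) (\<phi> \<zeta>) < inverse (Suc k)"
      "\<And>k. n k < n (Suc k)"
    by blast
  show "\<exists>n. strict_mono n \<and>
      uniform_limit K (\<lambda>k \<zeta>. hol_fun f (of_real (r (n k)) * \<zeta>)) \<phi> sequentially"
  proof (intro exI conjI uniform_limitI)
    show "strict_mono n"
      using n(2) by (simp add: strict_mono_Suc_iff)
    fix e :: real assume "e > 0"
    then have "eventually (\<lambda>k. inverse (real (Suc k)) < e) sequentially"
      using order_tendstoD(2)[OF LIMSEQ_inverse_real_of_nat] by blast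
    then show "eventually (\<lambda>k. \<forall>\<zeta>\<in>K. dist (hol_fun f (of_real (r (n k)) * \<zeta>)) (\<phi> \<zeta>) < e) sequentially"
      by eventually_elim (use n(1) in \<open>meson less_trans\<close>)
  qed
qed

section \<open>Pointwise values of polynomial expressions\<close>

lemma hol_fun_sum:
  "z \<in> ball 0 1 \<Longrightarrow> hol_fun (\<Sum>i\<in>I. f i) z = (\<Sum>i\<in>I. hol_fun (f i) z)"
  by (induction I rule: infinite_finite_induct) (auto simp: hol_fun_ops)

lemma hol_fun_prod:
  "z \<in> ball 0 1 \<Longrightarrow> hol_fun (\<Prod>i\<in>I. f i) z = (\<Prod>i\<in>I. hol_fun (f i) z)"
  by (induction I rule: infinite_finite_induct) (auto simp: hol_fun_ops)

lemma hol_fun_power: "z \<in> ball 0 1 \<Longrightarrow> hol_fun (f ^ n) z = hol_fun f z ^ n"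
  by (induction n) (auto simp: hol_fun_ops)

lemma hol_fun_eval_cpoly:
  assumes "z \<in> ball 0 1"
  shows "hol_fun (eval_cpoly P b) z = (\<Sum>m\<in>Poly_Mapping.keys P.
    Poly_Mapping.lookup P m * (\<Prod>i\<in>Poly_Mapping.keys m. hol_fun (b i) z ^ Poly_Mapping.lookup m i))"
  using assms
  by (simp add: eval_cpoly_def hol_fun_sum hol_fun_prod hol_fun_power hol_fun_ops)

section \<open>Kronecker substitution\<close>

text \<open>The map \<open>\<sigma>\<close> need not be injective, because the arguments of a polynomial may repeat in a
  generated subalgebra.\<close>

definition weight :: "nat \<Rightarrow> (nat \<Rightarrow> nat) \<Rightarrow> (nat \<Rightarrow>\<^sub>0 nat) \<Rightarrow> nat" where
  "weight d \<sigma> m = (\<Sum>i\<in>Poly_Mapping.keys m. d ^ \<sigma> i * Poly_Mapping.lookup m i)"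

text \<open>The image of \<open>P\<close> when variable \<open>i\<close> is replaced by the power
  \<open>d ^ \<sigma> i\<close> of a single variable. Monomials of equal weight add up and may
  cancel.\<close>

definition kronecker_poly :: "nat \<Rightarrow> (nat \<Rightarrow> nat) \<Rightarrow> cpoly \<Rightarrow> complex poly" where
  "kronecker_poly d \<sigma> P =
     (\<Sum>m\<in>Poly_Mapping.keys P. monom (Poly_Mapping.lookup P m) (weight d \<sigma> m))"

lemma poly_kronecker_poly:
  "poly (kronecker_poly d \<sigma> P) w = (\<Sum>m\<in>Poly_Mapping.keys P. Poly_Mapping.lookup P m *
     (\<Prod>i\<in>Poly_Mapping.keys m. (w ^ (d ^ \<sigma> i)) ^ Poly_Mapping.lookup m i))"
  by (simp add: kronecker_poly_def poly_sum poly_monom weight_def power_sum power_mult)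

text \<open>Products of uniform limits need bounded limit functions; compactness of \<open>K\<close>
  and continuity supply the bound.\<close>

lemma uniform_limit_mult_compact:
  fixes f g :: "'i \<Rightarrow> 'b::topological_space \<Rightarrow> complex"
  assumes "uniform_limit K f l F" "uniform_limit K g m F"
    and "compact K" "continuous_on K l" "continuous_on K m"
  shows "uniform_limit K (\<lambda>i x. f i x * g i x) (\<lambda>x. l x * m x) F"
  using assms
  by (intro uniform_lim_mult compact_imp_bounded compact_continuous_image)

lemma uniform_limit_power_compact:
  fixes f :: "'i \<Rightarrow> 'b::topological_space \<Rightarrow> complex"
  assumes "uniform_limit K f l F" "compact K" "continuous_on K l"
  shows "uniform_limit K (\<lambda>i x. f i x ^ n) (\<lambda>x. l x ^ n) F"
  using assms
  by (induction n) (auto intro!: uniform_limit_mult_compact uniform_limit_const continuous_intros)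

lemma uniform_limit_prod_compact:
  fixes f :: "'a \<Rightarrow> 'i \<Rightarrow> 'b::topological_space \<Rightarrow> complex"
  assumes "\<And>a. a \<in> A \<Longrightarrow> uniform_limit K (f a) (l a) F" "compact K"
    "\<And>a. a \<in> A \<Longrightarrow> continuous_on K (l a)"
  shows "uniform_limit K (\<lambda>i x. \<Prod>a\<in>A. f a i x) (\<lambda>x. \<Prod>a\<in>A. l a x) F"
  using assms
  by (induction A rule: infinite_finite_induct)
     (auto intro!: uniform_limit_mult_compact uniform_limit_const continuous_intros)

lemma uniform_limit_sum:
  fixes f :: "'a \<Rightarrow> 'i \<Rightarrow> 'b \<Rightarrow> 'c::real_normed_vector"
  assumes "\<And>a. a \<in> A \<Longrightarrow> uniform_limit K (f a) (l a) F"
  shows "uniform_limit K (\<lambda>i x. \<Sum>a\<in>A. f a i x) (\<lambda>x. \<Sum>a\<in>A. l a x) F"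
  using assms
  by (induction A rule: infinite_finite_induct) (auto intro!: uniform_limit_intros)

text \<open>A rational \<open>q\<close> is chosen with \<open>p(q)\<close> close to the target,
  where \<open>p\<close> is the Kronecker polynomial. Along the radii on which every
  \<open>F j\<close> tends to \<open>q ^ (d ^ j)\<close>, the given polynomial expression tends to
  \<open>p(q)\<close>.\<close>

lemma eval_cpoly_in_U_A:
  assumes F: "circle_universal r F" and r: "\<And>n. r n \<in> {0..<1}"
    and deg: "degree (kronecker_poly d \<sigma> P) > 0"
  shows "eval_cpoly P (\<lambda>i. F (\<sigma> i)) \<in> U_A r"
proof (rule U_A_I)
  fix K :: "complex set" and \<phi> :: "complex \<Rightarrow> complex" and e :: real and N :: nat
  assume K: "compact K" "K \<subseteq> sphere 0 1" "K \<noteq> sphere 0 1" and "continuous_on K \<phi>" "e > 0"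
  define f where "f = hol_fun (eval_cpoly P (\<lambda>i. F (\<sigma> i)))"
  define p where "p = kronecker_poly d \<sigma> P"
  obtain xs where xs: "\<And>\<zeta>. \<zeta> \<in> K \<Longrightarrow> dist (poly p (poly (rat_poly xs) \<zeta>)) (\<phi> \<zeta>) < e / 2"
    using rat_poly_circle_lift_approx[OF deg K \<open>continuous_on K \<phi>\<close>, of "e / 2"] \<open>e > 0\<close>
    unfolding p_def by auto
  obtain n where n: "filterlim n at_top sequentially"
      "\<And>j. uniform_limit K (\<lambda>i \<zeta>. hol_fun (F j) (of_real (r (n i)) * \<zeta>))
         (\<lambda>\<zeta>. poly (rat_poly xs) \<zeta> ^ (d ^ j)) sequentially"
    using F K unfolding circle_universal_def by meson
  have in_ball: "of_real (r m) * \<zeta> \<in> ball 0 1" if "\<zeta> \<in> K" for m \<zeta>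
    using r[of m] that K by (auto simp: norm_mult)
  have "uniform_limit K (\<lambda>i \<zeta>. \<Sum>m\<in>Poly_Mapping.keys P. Poly_Mapping.lookup P m *
      (\<Prod>i'\<in>Poly_Mapping.keys m. hol_fun (F (\<sigma> i')) (of_real (r (n i)) * \<zeta>) ^ Poly_Mapping.lookup m i'))
    (\<lambda>\<zeta>. poly p (poly (rat_poly xs) \<zeta>)) sequentially"
    unfolding p_def poly_kronecker_poly
    by (intro uniform_limit_sum uniform_limit_mult_compact uniform_limit_prod_compact
        uniform_limit_power_compact uniform_limit_const n K continuous_intros)
  then have "uniform_limit K (\<lambda>i \<zeta>. f (of_real (r (n i)) * \<zeta>))
      (\<lambda>\<zeta>. poly p (poly (rat_poly xs) \<zeta>)) sequentially"
    by (rule uniform_limit_cong'[THEN iffD1, rotated 2])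
       (simp_all add: f_def hol_fun_eval_cpoly[OF in_ball])
  then have "eventually (\<lambda>i. \<forall>\<zeta>\<in>K. dist (f (of_real (r (n i)) * \<zeta>))
      (poly p (poly (rat_poly xs) \<zeta>)) < e / 2) sequentially"
    using \<open>e > 0\<close> by (intro uniform_limitD) auto
  moreover have "eventually (\<lambda>i. N < n i) sequentially"
    using n(1) unfolding filterlim_at_top by (simp flip: Suc_le_eq)
  ultimately have "eventually (\<lambda>i. N < n i \<and> (\<forall>\<zeta>\<in>K. dist (f (of_real (r (n i)) * \<zeta>))
      (poly p (poly (rat_poly xs) \<zeta>)) < e / 2)) sequentially"
    by (rule eventually_conj[rotated])
  then obtain i where i: "N < n i" "\<And>\<zeta>. \<zeta> \<in> K \<Longrightarrow> dist (f (of_real (r (n i)) * \<zeta>))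
      (poly p (poly (rat_poly xs) \<zeta>)) < e / 2"
    using eventually_happens'[OF sequentially_bot] by blast
  have "dist (f (of_real (r (n i)) * \<zeta>)) (\<phi> \<zeta>) < e" if "\<zeta> \<in> K" for \<zeta>
    using i(2)[OF that] xs[OF that]
      dist_triangle[of "f (of_real (r (n i)) * \<zeta>)" "\<phi> \<zeta>" "poly p (poly (rat_poly xs) \<zeta>)"]
    by simp
  with i(1) show "\<exists>n>N. \<forall>\<zeta>\<in>K. dist (hol_fun (eval_cpoly P (\<lambda>i. F (\<sigma> i))) (of_real (r n) * \<zeta>)) (\<phi> \<zeta>) < e"
    by (auto simp: f_def)
qed

section \<open>Monomials grouped by weight\<close>

lemma scaleC_zero_left: "0 *\<^sub>C x = (0 :: 'a::comm_complex_algebra_1)"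
  using scaleC_add_left[of 0 0 x] by simp

lemma scaleC_sum_left: "(\<Sum>i\<in>I. c i) *\<^sub>C x = (\<Sum>i\<in>I. c i *\<^sub>C (x :: 'a::comm_complex_algebra_1))"
  by (induction I rule: infinite_finite_induct) (auto simp: scaleC_zero_left scaleC_add_left)

text \<open>The residue modulo \<open>d\<close> gives the lowest digit; cancelling it and dividing
  by \<open>d\<close> shifts the remaining ones.\<close>

lemma base_digits_unique:
  fixes u v :: "nat \<Rightarrow> nat"
  assumes "(\<Sum>j<J. d ^ j * u j) = (\<Sum>j<J. d ^ j * v j)"
    and "\<And>j. u j < d" "\<And>j. v j < d" "j < J"
  shows "u j = v j"
  using assms
proof (induction J arbitrary: u v j)
  case (Suc J)
  have split: "(\<Sum>j<Suc J. d ^ j * w j) = w 0 + d * (\<Sum>j<J. d ^ j * w (Suc j))" for w :: "nat \<Rightarrow> nat"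
    by (subst sum.lessThan_Suc_shift) (simp add: sum_distrib_left mult.assoc)
  have eq: "u 0 + d * (\<Sum>j<J. d ^ j * u (Suc j)) = v 0 + d * (\<Sum>j<J. d ^ j * v (Suc j))"
    using Suc.prems(1) unfolding split .
  have "(u 0 + d * (\<Sum>j<J. d ^ j * u (Suc j))) mod d = u 0"
    "(v 0 + d * (\<Sum>j<J. d ^ j * v (Suc j))) mod d = v 0"
    using Suc.prems(2,3) by simp_all
  with eq have 0: "u 0 = v 0"
    by metis
  moreover have "d > 0"
    using Suc.prems(2)[of 0] by simp
  ultimately have "(\<Sum>j<J. d ^ j * u (Suc j)) = (\<Sum>j<J. d ^ j * v (Suc j))"
    using eq by simp
  then have "u (Suc i) = v (Suc i)" if "i < J" for i
    using Suc.IH[of "\<lambda>j. u (Suc j)" "\<lambda>j. v (Suc j)"] Suc.prems(2,3) that by blast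
  with 0 Suc.prems(4) show ?case
    by (cases j) auto
qed simp

text \<open>The exponent of \<open>F j\<close> in the monomial once variables with the same
  \<open>\<sigma>\<close>-value are merged. For large \<open>d\<close> these numbers are the base
  \<open>d\<close> digits of the weight.\<close>

definition collapse :: "(nat \<Rightarrow> nat) \<Rightarrow> (nat \<Rightarrow>\<^sub>0 nat) \<Rightarrow> nat \<Rightarrow> nat" where
  "collapse \<sigma> m j = (\<Sum>i\<in>{i \<in> Poly_Mapping.keys m. \<sigma> i = j}. Poly_Mapping.lookup m i)"

lemma weight_collapse:
  assumes "\<sigma> ` Poly_Mapping.keys m \<subseteq> {..<J}"
  shows "weight d \<sigma> m = (\<Sum>j<J. d ^ j * collapse \<sigma> m j)"
proof -
  have "weight d \<sigma> m = (\<Sum>j<J. \<Sum>i\<in>{i \<in> Poly_Mapping.keys m. \<sigma> i = j}. d ^ \<sigma> i * Poly_Mapping.lookup m i)"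
    unfolding weight_def using assms by (intro sum.group[symmetric]) auto
  also have "\<dots> = (\<Sum>j<J. d ^ j * collapse \<sigma> m j)"
    by (simp add: collapse_def sum_distrib_left)
  finally show ?thesis .
qed

lemma monomial_collapse:
  fixes b :: "nat \<Rightarrow> 'a::comm_monoid_mult"
  assumes "\<sigma> ` Poly_Mapping.keys m \<subseteq> {..<J}"
  shows "(\<Prod>i\<in>Poly_Mapping.keys m. b (\<sigma> i) ^ Poly_Mapping.lookup m i) = (\<Prod>j<J. b j ^ collapse \<sigma> m j)"
proof -
  have "(\<Prod>i\<in>Poly_Mapping.keys m. b (\<sigma> i) ^ Poly_Mapping.lookup m i) =
      (\<Prod>j<J. \<Prod>i\<in>{i \<in> Poly_Mapping.keys m. \<sigma> i = j}. b (\<sigma> i) ^ Poly_Mapping.lookup m i)"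
    using assms by (intro prod.group[symmetric]) auto
  also have "\<dots> = (\<Prod>j<J. b j ^ collapse \<sigma> m j)"
    by (simp add: collapse_def power_sum)
  finally show ?thesis .
qed

lemma collapse_inj:
  assumes "inj_on \<sigma> I" "Poly_Mapping.keys m \<subseteq> I" "i \<in> I"
  shows "collapse \<sigma> m (\<sigma> i) = Poly_Mapping.lookup m i"
proof (cases "i \<in> Poly_Mapping.keys m")
  case True
  then have "{i' \<in> Poly_Mapping.keys m. \<sigma> i' = \<sigma> i} = {i}"
    using assms by (auto dest: inj_onD)
  then show ?thesis by (simp add: collapse_def)
next
  case False
  then have "{i' \<in> Poly_Mapping.keys m. \<sigma> i' = \<sigma> i} = {}"
    using assms by (auto dest: inj_onD)
  then show ?thesis
    using False by (simp add: collapse_def in_keys_iff)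
qed

lemma exists_kronecker_base:
  obtains d J where "\<And>m. m \<in> Poly_Mapping.keys P \<Longrightarrow> \<sigma> ` Poly_Mapping.keys m \<subseteq> {..<J}"
    "\<And>m m' j. m \<in> Poly_Mapping.keys (P :: cpoly) \<Longrightarrow> m' \<in> Poly_Mapping.keys P
       \<Longrightarrow> weight d \<sigma> m = weight d \<sigma> m' \<Longrightarrow> collapse \<sigma> m j = collapse \<sigma> m' j"
    "d > 0"
proof -
  have "finite (\<Union>m\<in>Poly_Mapping.keys P. \<sigma> ` Poly_Mapping.keys m)"
    by auto
  then obtain J where J: "(\<Union>m\<in>Poly_Mapping.keys P. \<sigma> ` Poly_Mapping.keys m) \<subseteq> {..<J}"
    by (metis finite_nat_bounded)
  define size where "size m = (\<Sum>i\<in>Poly_Mapping.keys m. Poly_Mapping.lookup m i)" for m :: "nat \<Rightarrow>\<^sub>0 nat"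
  \<comment> \<open>Larger than the total degree of every monomial of \<open>P\<close>, hence larger
    than every merged exponent, so that these are genuine digits.\<close>
  define d where "d = Suc (\<Sum>m\<in>Poly_Mapping.keys P. size m)"
  have bound: "collapse \<sigma> m j < d" if "m \<in> Poly_Mapping.keys P" for m j
  proof -
    have "collapse \<sigma> m j \<le> size m"
      unfolding collapse_def size_def by (intro sum_mono2) auto
    also have "size m \<le> (\<Sum>m\<in>Poly_Mapping.keys P. size m)"
      using that by (intro member_le_sum) auto
    finally show ?thesis by (simp add: d_def)
  qed
  have sub: "\<sigma> ` Poly_Mapping.keys m \<subseteq> {..<J}" if "m \<in> Poly_Mapping.keys P" for m
    using J that by blast
  show thesis
  proof (rule that[of J d])
    fix m m' j
    assume m: "m \<in> Poly_Mapping.keys P" "m' \<in> Poly_Mapping.keys P" "weight d \<sigma> m = weight d \<sigma> m'"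
    show "collapse \<sigma> m j = collapse \<sigma> m' j"
    proof (cases "j < J")
      case True
      then show ?thesis
        using m weight_collapse[OF sub] bound
        by (intro base_digits_unique[of d "collapse \<sigma> m" J "collapse \<sigma> m'"]) auto
    next
      case False
      then have "{i \<in> Poly_Mapping.keys m. \<sigma> i = j} = {}" "{i \<in> Poly_Mapping.keys m'. \<sigma> i = j} = {}"
        using sub m(1,2) by blast+
      then show ?thesis
        by (simp only: collapse_def sum.empty)
    qed
  qed (use sub in \<open>auto simp: d_def\<close>)
qed

lemma coeff_kronecker_poly:
  "coeff (kronecker_poly d \<sigma> P) k =
     (\<Sum>m\<in>{m \<in> Poly_Mapping.keys P. weight d \<sigma> m = k}. Poly_Mapping.lookup P m)"
  unfolding kronecker_poly_def
  by (simp add: coeff_sum sum.inter_filter[symmetric] if_distrib cong: if_cong)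

text \<open>For the chosen base, monomials of equal weight become the same product of the
  \<open>F j\<close>, so the value is a sum over weights \<open>k\<close> of
  \<open>coeff p k\<close> times one product. If \<open>p\<close> is constant, only weight 0
  survives, and its product is empty. The last clause serves algebraic independence: for distinct
  arguments the weight determines the monomial, so no coefficient of \<open>P\<close> can cancel in
  \<open>p\<close>.\<close>

lemma eval_cpoly_in_U_A_or_const:
  fixes F :: "nat \<Rightarrow> disc_hol"
  assumes F: "circle_universal r F" and r: "\<And>n. r n \<in> {0..<1}"
  obtains "eval_cpoly P (\<lambda>i. F (\<sigma> i)) \<in> U_A r"
    | c where "eval_cpoly P (\<lambda>i. F (\<sigma> i)) = c *\<^sub>C 1"
      "\<And>I. P \<noteq> 0 \<Longrightarrow> inj_on \<sigma> I \<Longrightarrow> (\<And>m. m \<in> Poly_Mapping.keys P \<Longrightarrow> Poly_Mapping.keys m \<subseteq> I) \<Longrightarrow> c \<noteq> 0"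
proof -
  let ?S = "Poly_Mapping.keys P"
  obtain d J where J: "\<And>m. m \<in> ?S \<Longrightarrow> \<sigma> ` Poly_Mapping.keys m \<subseteq> {..<J}"
    and det: "\<And>m m' j. m \<in> ?S \<Longrightarrow> m' \<in> ?S \<Longrightarrow> weight d \<sigma> m = weight d \<sigma> m'
       \<Longrightarrow> collapse \<sigma> m j = collapse \<sigma> m' j"
    and "d > 0"
    by (rule exists_kronecker_base[of P \<sigma>]) blast
  define p where "p = kronecker_poly d \<sigma> P"
  show thesis
  proof (cases "degree p > 0")
    case True
    then show ?thesis
      using that(1) eval_cpoly_in_U_A[OF F r] unfolding p_def by blast
  next
    case False
    then have p: "p = [:coeff p 0:]"
      by (metis gr0I degree_eq_zeroE coeff_pCons_0)
    define M where "M m = (\<Prod>i\<in>Poly_Mapping.keys m. F (\<sigma> i) ^ Poly_Mapping.lookup m i)" for m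
    have M_eq: "M m = M m'" if "m \<in> ?S" "m' \<in> ?S" "weight d \<sigma> m = weight d \<sigma> m'" for m m'
      unfolding M_def using that J det[OF that] by (subst (1 2) monomial_collapse) auto
    have M_1: "M m = 1" if "m \<in> ?S" "weight d \<sigma> m = 0" for m
      using that(2) \<open>d > 0\<close> by (simp add: weight_def M_def)
    \<comment> \<open>For \<open>k = 0\<close> the common product is 1; for other \<open>k\<close>
      the coefficient is 0, so the product may be replaced by 1 all the same.\<close>
    have group: "(\<Sum>m\<in>{m \<in> ?S. weight d \<sigma> m = k}. Poly_Mapping.lookup P m *\<^sub>C M m) = coeff p k *\<^sub>C 1" for k
    proof (cases "{m \<in> ?S. weight d \<sigma> m = k} = {}")
      case True
      then show ?thesis
        by (simp only: p_def coeff_kronecker_poly sum.empty scaleC_zero_left)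
    next
      case False
      then obtain m0 where m0: "m0 \<in> ?S" "weight d \<sigma> m0 = k"
        by auto
      have "M m = M m0" if "m \<in> {m \<in> ?S. weight d \<sigma> m = k}" for m
        using M_eq[of m m0] m0 that by auto
      then have "(\<Sum>m\<in>{m \<in> ?S. weight d \<sigma> m = k}. Poly_Mapping.lookup P m *\<^sub>C M m)
          = (\<Sum>m\<in>{m \<in> ?S. weight d \<sigma> m = k}. Poly_Mapping.lookup P m *\<^sub>C M m0)"
        by (intro sum.cong) simp_all
      also have "\<dots> = coeff p k *\<^sub>C M m0"
        by (simp add: p_def coeff_kronecker_poly scaleC_sum_left)
      also have "\<dots> = coeff p k *\<^sub>C 1"
      proof (cases "k = 0")
        case True
        then show ?thesis using M_1 m0 by simp
      next
        case False
        then have "coeff p k = 0"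
          by (subst p) (simp add: coeff_pCons split: nat.splits)
        then show ?thesis by (simp add: scaleC_zero_left)
      qed
      finally show ?thesis .
    qed
    have "eval_cpoly P (\<lambda>i. F (\<sigma> i)) = (\<Sum>m\<in>?S. Poly_Mapping.lookup P m *\<^sub>C M m)"
      by (simp add: eval_cpoly_def M_def)
    \<comment> \<open>Weight 0 is inserted so that the term \<open>coeff p 0\<close> is present even
      if no monomial of \<open>P\<close> has this weight.\<close>
    also have "\<dots> = (\<Sum>k\<in>insert 0 (weight d \<sigma> ` ?S). coeff p k *\<^sub>C 1)"
      unfolding group[symmetric] by (intro sum.group[symmetric]) auto
    also have "\<dots> = (\<Sum>k\<in>{0}. coeff p k *\<^sub>C 1)"
    proof (rule sum.mono_neutral_right)
      show "\<forall>k\<in>insert 0 (weight d \<sigma> ` ?S) - {0}. coeff p k *\<^sub>C 1 = (0 :: disc_hol)"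
        by (subst p) (auto simp: coeff_pCons scaleC_zero_left split: nat.splits)
    qed auto
    finally have eval: "eval_cpoly P (\<lambda>i. F (\<sigma> i)) = coeff p 0 *\<^sub>C 1"
      by simp
    show ?thesis
    proof (rule that(2)[OF eval])
      fix I assume "P \<noteq> 0" and inj: "inj_on \<sigma> I" and I: "\<And>m. m \<in> ?S \<Longrightarrow> Poly_Mapping.keys m \<subseteq> I"
      then obtain m where m: "m \<in> ?S"
        by (metis all_not_in_conv keys_eq_empty)
      have "m' = m" if m': "m' \<in> ?S" "weight d \<sigma> m' = weight d \<sigma> m" for m'
      proof (rule poly_mapping_eqI)
        fix i
        show "Poly_Mapping.lookup m' i = Poly_Mapping.lookup m i"
        proof (cases "i \<in> I")
          case True
          then show ?thesis
            using det[OF m'(1) m m'(2), of "\<sigma> i"] collapse_inj[OF inj I] m m'(1) by simp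
        next
          case False
          then show ?thesis
            using I[OF m] I[OF m'(1)] by (metis in_keys_iff subsetD)
        qed
      qed
      then have "{m' \<in> ?S. weight d \<sigma> m' = weight d \<sigma> m} = {m}"
        using m by blast
      then have "coeff p (weight d \<sigma> m) = Poly_Mapping.lookup P m"
        by (simp add: p_def coeff_kronecker_poly)
      then have "p \<noteq> 0"
        using m by (auto simp: in_keys_iff)
      then show "coeff p 0 \<noteq> 0"
        using p by auto
    qed
  qed
qed

section \<open>Nonvanishing and infinitely many generators\<close>

lemma scaleC_one_eq_0_iff: "c *\<^sub>C (1 :: disc_hol) = 0 \<longleftrightarrow> c = 0"
proof
  assume "c *\<^sub>C (1 :: disc_hol) = 0"
  then have "hol_fun (c *\<^sub>C 1) 0 = hol_fun 0 0"
    by simp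
  then show "c = 0"
    by (simp add: hol_fun_ops)
qed (simp add: scaleC_zero_left)

lemma singleton_neq_unit_circle: "{1} \<noteq> sphere (0::complex) 1"
  by (metis insertI1 mem_sphere_0 norm_minus_cancel norm_one one_neq_neg_one singletonD)

text \<open>At the single point 1 the zero function keeps distance 1 from the target 1. This turns
  membership in the class into nonvanishing.\<close>

lemma zero_notin_U_A:
  assumes r: "\<And>n. r n \<in> {0..<1}"
  shows "0 \<notin> U_A r"
proof
  assume "0 \<in> U_A r"
  then obtain n where n: "(\<lambda>k. SUP \<zeta>\<in>{1}. ennreal (norm (hol_fun 0 (of_real (r (n k)) * \<zeta>) - 1))) \<longlonglongrightarrow> 0"
    unfolding U_A_def mem_Collect_eq using singleton_neq_unit_circle
    by (elim allE[of _ "{1}"] allE[of _ "\<lambda>_. 1"]) (auto simp: continuous_on_const)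
  have "complex_of_real (r k) \<in> ball 0 1" for k
    using r[of k] by simp
  then have "hol_fun 0 (of_real (r k)) = 0" for k
    by (simp only: hol_fun_ops)
  with n show False
    by (simp add: LIMSEQ_const_iff)
qed

text \<open>Tested at the point 1 with the constant polynomial 2 and base 2: the values of
  \<open>F j\<close> tend to \<open>2 ^ (2 ^ j)\<close>, and these limits differ.\<close>

lemma circle_universal_inj:
  assumes F: "circle_universal r F"
  shows "inj F"
proof
  fix i j assume eq: "F i = F j"
  obtain n :: "nat \<Rightarrow> nat" where n: "\<And>j. uniform_limit {1} (\<lambda>i \<zeta>. hol_fun (F j) (of_real (r (n i)) * \<zeta>))
         (\<lambda>\<zeta>. poly (rat_poly [(2, 0)]) \<zeta> ^ (2 ^ j)) sequentially"
    using F singleton_neq_unit_circle unfolding circle_universal_def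
    by (metis compact_sing empty_subsetI insert_subset mem_sphere_0 norm_one)
  have "(poly (rat_poly [(2, 0)]) 1 :: complex) ^ 2 ^ i = poly (rat_poly [(2, 0)]) 1 ^ 2 ^ j"
    using tendsto_uniform_limitI[OF n[of i], of 1] tendsto_uniform_limitI[OF n[of j], of 1] eq
    by (intro LIMSEQ_unique) auto
  moreover have "poly (rat_poly [(2, 0)]) 1 = (2 :: complex)"
    by (simp add: rat_poly_def rat_complex_def complex_eq_iff)
  ultimately have "(2::complex) ^ 2 ^ i = 2 ^ 2 ^ j"
    by simp
  then have "norm ((2::complex) ^ 2 ^ i) = norm ((2::complex) ^ 2 ^ j)"
    by simp
  then show "i = j"
    by (simp add: norm_power)
qed

theorem theorem2p7:
  fixes r :: "nat \<Rightarrow> real"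
  assumes "incseq r" and "\<And>n. r n \<in> {0..<1}" and "r \<longlonglongrightarrow> 1"
  shows "strongly_algebrable (U_A r)"
proof -
  obtain F where F: "circle_universal r F"
    using exists_circle_universal[OF assms] .
  have inj: "inj F"
    by (rule circle_universal_inj[OF F])
  \<comment> \<open>The index of the generator used as argument \<open>i\<close>. For
    \<open>i \<ge> n\<close> the argument need not be a generator and the index is arbitrary, but a
    polynomial in \<open>cpolys n\<close> never reads it.\<close>
  define \<sigma> where "\<sigma> b i = inv F (b i)" for b :: "nat \<Rightarrow> disc_hol" and i :: nat
  have eval: "eval_cpoly P b = eval_cpoly P (\<lambda>i. F (\<sigma> b i))"
    if P: "P \<in> cpolys n" and b: "\<forall>i<n. b i \<in> range F" for P b n
  proof -
    have "(\<Prod>i\<in>Poly_Mapping.keys m. b i ^ Poly_Mapping.lookup m i)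
        = (\<Prod>i\<in>Poly_Mapping.keys m. F (\<sigma> b i) ^ Poly_Mapping.lookup m i)"
      if "m \<in> Poly_Mapping.keys P" for m
    proof (rule prod.cong)
      fix i assume "i \<in> Poly_Mapping.keys m"
      then have "i < n"
        using P that by (auto simp: cpolys_def)
      with b show "b i ^ Poly_Mapping.lookup m i = F (\<sigma> b i) ^ Poly_Mapping.lookup m i"
        by (simp add: \<sigma>_def f_inv_into_f)
    qed simp
    then show ?thesis
      by (simp add: eval_cpoly_def)
  qed
  have "infinite (range F)"
    using inj by (simp add: finite_image_iff)
  moreover have "algebraically_independent (range F)"
    unfolding algebraically_independent_def
  proof (intro allI impI, elim conjE)
    fix n b P
    assume inj_b: "inj_on b {..<n}" and b: "\<forall>i<n. b i \<in> range F" and P: "P \<in> cpolys n" "P \<noteq> 0"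
    have "inj_on (\<sigma> b) {..<n}"
    proof (rule inj_onI)
      fix i j assume ij: "i \<in> {..<n}" "j \<in> {..<n}" "\<sigma> b i = \<sigma> b j"
      then have "F (inv F (b i)) = F (inv F (b j))"
        by (simp add: \<sigma>_def)
      then have "b i = b j"
        using b ij by (simp add: f_inv_into_f)
      then show "i = j"
        using inj_b ij by (blast dest: inj_onD)
    qed
    moreover have "Poly_Mapping.keys m \<subseteq> {..<n}" if "m \<in> Poly_Mapping.keys P" for m
      using P(1) that by (simp add: cpolys_def)
    ultimately show "eval_cpoly P b \<noteq> 0"
      unfolding eval[OF P(1) b] using P(2) zero_notin_U_A[OF assms(2)]
      by (cases rule: eval_cpoly_in_U_A_or_const[OF F assms(2), of P "\<sigma> b"])
         (auto simp: scaleC_one_eq_0_iff)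
  qed
  moreover have "generated_subalgebra (range F) \<subseteq> U_A r \<union> {c *\<^sub>C 1 | c. True}"
  proof
    fix f assume "f \<in> generated_subalgebra (range F)"
    then obtain P b n where "P \<in> cpolys n" "\<forall>i<n. b i \<in> range F" "f = eval_cpoly P b"
      unfolding generated_subalgebra_def by blast
    then have f: "f = eval_cpoly P (\<lambda>i. F (\<sigma> b i))"
      using eval by metis
    show "f \<in> U_A r \<union> {c *\<^sub>C 1 | c. True}"
      unfolding f
      by (cases rule: eval_cpoly_in_U_A_or_const[OF F assms(2), of P "\<sigma> b"]) auto
  qed
  ultimately show ?thesis
    unfolding strongly_algebrable_def by blast
qed

end
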